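(* Let $A$ be a countable structure and let $v\in\{\omega_1^A,\omega_1^A+1\}$. Then $$\mathrm{SR}^{\mathrm{AK}}(A)=v\iff\mathrm{SR}^{\sim}(A)=v .$$ Moreover $\mathrm{SR}^{\mathrm{AK}}(A)\ge\omega_1^A\iff\mathrm{SR}^{\sim}(A)\ge\omega_1^A$.
   Context: Structures are countable structures in a countable vocabulary. $\omega_1^A=\min\{\omega_1^X:X\in2^\omega\text{ computes a copy of }A\}$. All tuples are finite tuples of $A$, and relations compare tuples of equal length. $\mathrm{SR}^{\sim}$: $\bar a\sim_0\bar b$ iff they have the same atomic type; $\bar a\sim_{\alpha+1}\bar b$ iff for every $c\in A$ there is $d\in A$ with $\bar ac\sim_\alpha\bar bd$ and for every $d\in A$ there is $c\in A$ with $\bar ac\sim_\alpha\bar bd$ (one-element extensions); at limits $\lambda$, $\bar a\sim_\lambda\bar b$ iff $\bar a\sim_\beta\bar b$ for all $\beta<\lambda$. $\rho^{\sim}(\bar a)$ is the least $\alpha$ such that every $\bar b$ with $\bar a\sim_\alpha\bar b$ is automorphic to $\bar a$ in $A$. $\mathrm{SR}^{\sim}(A)=\sup\{\rho^{\sim}(\bar a)+1:\bar a\in A^{<\omega}\}$. $\mathrm{SR}^{\mathrm{AK}}$ (Ash–Knight symmetric rank): $\bar a\sim^{\mathrm{AK}}_0\bar b$ iff they satisfy the same open (finitary quantifier-free) formulas; for $\beta>0$, $\bar a\sim^{\mathrm{AK}}_\beta\bar b$ iff for every $\gamma<\beta$: for every finite tuple $\bar c$ there is $\bar d$ with $\bar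 a\bar c\sim^{\mathrm{AK}}_\gamma\bar b\bar d$, and for every finite tuple $\bar d$ there is $\bar c$ with $\bar a\bar c\sim^{\mathrm{AK}}_\gamma\bar b\bar d$. $\rho^{\mathrm{AK}}(\bar a)$ is the least $\beta$ such that every $\bar b$ with $\bar a\sim^{\mathrm{AK}}_\beta\bar b$ satisfies the same $L_{\omega_1\omega}$ formulas as $\bar a$. $\mathrm{SR}^{\mathrm{AK}}(A)=\sup\{\rho^{\mathrm{AK}}(\bar a)+1:\bar a\in A^{<\omega}\}$. *)

theory Defs
  imports Main "HOL-Library.Nat_Bijection" "HOL-Library.Countable_Set_Type"
begin

unbundle cardinal_syntax

subsection \<open>Countable ordinals\<close>

text \<open>
  The points of the well-order \<open>cardSuc natLeq\<close> (that is, of \<open>\<omega>\<^sub>1\<close>) serve as the countable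
  ordinals, a point being identified with the order type of the set of points below it.  Every
  ordinal attached to a countable structure below is countable, so this is enough ordinals.
\<close>

typedef cord = "Field (cardSuc natLeq)"
  using Field_cardSuc_not_empty natLeq_Card_order by blast

instantiation cord :: ord
begin

definition less_eq_cord :: "cord \<Rightarrow> cord \<Rightarrow> bool" where
  "\<alpha> \<le> \<beta> \<longleftrightarrow> (Rep_cord \<alpha>, Rep_cord \<beta>) \<in> cardSuc natLeq"

definition less_cord :: "cord \<Rightarrow> cord \<Rightarrow> bool" where
  "\<alpha> < \<beta> \<longleftrightarrow> \<alpha> \<le> \<beta> \<and> \<alpha> \<noteq> (\<beta> :: cord)"

instance ..

end

lemma Well_order_omega1: "Well_order (cardSuc natLeq)"
  by (rule cardSuc_Well_order[OF natLeq_Card_order])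

instance cord :: wellorder
proof
  note wo = Well_order_omega1[unfolded well_order_on_def linear_order_on_def partial_order_on_def
      preorder_on_def]
  fix x y z :: cord
  show refl: "x \<le> x" for x :: cord
    using wo Rep_cord[of x] by (auto simp: less_eq_cord_def refl_on_def)
  show trans: "x \<le> y \<Longrightarrow> y \<le> z \<Longrightarrow> x \<le> z"
    using wo by (auto simp: less_eq_cord_def elim: transE)
  show anti: "x \<le> y \<Longrightarrow> y \<le> x \<Longrightarrow> x = y" for x y :: cord
    using wo by (metis antisymD less_eq_cord_def Rep_cord_inject)
  show "(x < y) = (x \<le> y \<and> \<not> y \<le> x)"
    using anti refl by (auto simp: less_cord_def)
  show "x \<le> y \<or> y \<le> x"
    using wo Rep_cord[of x] Rep_cord[of y] refl[of x]
    by (cases "x = y") (auto simp: less_eq_cord_def total_on_def Rep_cord_inject)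
next
  fix P :: "cord \<Rightarrow> bool" and a :: cord
  assume step: "\<And>x. (\<And>y. y < x \<Longrightarrow> P y) \<Longrightarrow> P x"
  have "wf (inv_image (cardSuc natLeq - Id) Rep_cord)"
    using Well_order_omega1 by (simp add: well_order_on_def wf_inv_image)
  then show "P a"
  proof (induction a rule: wf_induct_rule)
    case (less x)
    show ?case
      by (rule step, rule less)
        (auto simp: less_cord_def less_eq_cord_def in_inv_image Rep_cord_inject)
  qed
qed

lemma countable_cord_atMost: "countable {.. \<alpha> :: cord}"
proof -
  let ?S = "underS (cardSuc natLeq) (Rep_cord \<alpha>)"
  have "|?S| <o cardSuc natLeq"
    by (rule card_of_underS[OF cardSuc_Card_order[OF natLeq_Card_order] Rep_cord])
  then have "|?S| \<le>o natLeq"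
    using cardSuc_ordLeq_ordLess[OF natLeq_Card_order card_of_Card_order] by blast
  then have "countable ?S"
    by (simp add: countable_card_le_natLeq)
  moreover have "{..\<alpha>} \<subseteq> insert \<alpha> (Abs_cord ` ?S)"
  proof
    fix \<beta> assume "\<beta> \<in> {..\<alpha>}"
    then have "\<beta> = \<alpha> \<or> Rep_cord \<beta> \<in> ?S"
      by (auto simp: underS_def less_eq_cord_def Rep_cord_inject)
    then show "\<beta> \<in> insert \<alpha> (Abs_cord ` ?S)"
      by (metis Rep_cord_inverse image_eqI insert_iff)
  qed
  ultimately show ?thesis
    by (meson countable_image countable_insert countable_subset)
qed

lemma uncountable_cord: "uncountable (UNIV :: cord set)"
proof
  assume "countable (UNIV :: cord set)"
  then have "countable (Rep_cord ` UNIV)" by blast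
  then have "countable (Field (cardSuc natLeq))"
    using type_definition.Rep_range[OF type_definition_cord] by simp
  then have "|Field (cardSuc natLeq)| \<le>o natLeq"
    by (simp add: countable_card_le_natLeq)
  moreover have "|Field (cardSuc natLeq)| =o cardSuc natLeq"
    by (rule card_of_Field_ordIso[OF cardSuc_Card_order[OF natLeq_Card_order]])
  ultimately have "cardSuc natLeq \<le>o natLeq"
    using ordIso_ordLeq_trans ordIso_symmetric by blast
  then show False
    using cardSuc_greater[OF natLeq_Card_order] not_ordLess_ordLeq by blast
qed

lemma countable_cord_bounded:
  fixes S :: "cord set"
  assumes "countable S"
  shows "\<exists>\<beta>. \<forall>\<alpha>\<in>S. \<alpha> < \<beta>"
proof (rule ccontr)
  assume "\<not> ?thesis"
  then have "(UNIV :: cord set) = (\<Union>\<alpha>\<in>S. {..\<alpha>})"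
    by (auto simp: not_less)
  moreover have "countable (\<Union>\<alpha>\<in>S. {..\<alpha>})"
    using assms countable_cord_atMost by blast
  ultimately show False
    using uncountable_cord by simp
qed

instantiation cord :: zero
begin
definition zero_cord :: cord where "0 = (LEAST \<alpha> :: cord. True)"
instance ..
end

definition osuc :: "cord \<Rightarrow> cord" where
  "osuc \<alpha> = (LEAST \<beta>. \<alpha> < \<beta>)"

lemma less_osuc: "\<alpha> < osuc \<alpha>"
proof -
  obtain \<beta> where "\<alpha> < \<beta>"
    using countable_cord_bounded[of "{\<alpha>}"] by auto
  then show ?thesis
    unfolding osuc_def by (rule LeastI)
qed

definition osup :: "cord set \<Rightarrow> cord" where
  "osup S = (LEAST \<beta>. \<forall>\<alpha>\<in>S. \<alpha> \<le> \<beta>)"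

lemma osup_le_iff:
  assumes "countable S"
  shows "osup S \<le> \<beta> \<longleftrightarrow> (\<forall>\<alpha>\<in>S. \<alpha> \<le> \<beta>)"
proof -
  obtain \<gamma> where "\<forall>\<alpha>\<in>S. \<alpha> \<le> \<gamma>"
    using countable_cord_bounded[OF assms] by (meson less_imp_le)
  then have "\<forall>\<alpha>\<in>S. \<alpha> \<le> osup S"
    unfolding osup_def by (rule LeastI)
  then show ?thesis
    unfolding osup_def by (auto intro: Least_le order_trans)
qed

subsection \<open>Relative computability\<close>

text \<open>
  \<open>rec_in X n f\<close>: the total \<open>n\<close>-ary function \<open>f\<close> is recursive in the oracle \<open>X\<close>
  (Shoenfield's definition, with minimization of regular functions).  Only the values of \<open>f\<close> on
  lists of length \<open>n\<close> matter.
\<close>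

inductive rec_in :: "nat set \<Rightarrow> nat \<Rightarrow> (nat list \<Rightarrow> nat) \<Rightarrow> bool" for X :: "nat set" where
  zero: "rec_in X n (\<lambda>_. 0)"
| succ: "rec_in X 1 (\<lambda>xs. Suc (xs ! 0))"
| proj: "i < n \<Longrightarrow> rec_in X n (\<lambda>xs. xs ! i)"
| orac: "rec_in X 1 (\<lambda>xs. of_bool (xs ! 0 \<in> X))"
| comp: "rec_in X (length hs) g \<Longrightarrow> (\<forall>h\<in>set hs. rec_in X n h) \<Longrightarrow>
    rec_in X n (\<lambda>xs. g (map (\<lambda>h. h xs) hs))"
| prec: "rec_in X n g \<Longrightarrow> rec_in X (Suc (Suc n)) h \<Longrightarrow>
    rec_in X (Suc n) (\<lambda>xs. rec_nat (g (tl xs)) (\<lambda>k r. h (k # r # tl xs)) (hd xs))"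
| mini: "rec_in X (Suc n) g \<Longrightarrow> (\<forall>xs. length xs = n \<longrightarrow> (\<exists>y. g (y # xs) = 0)) \<Longrightarrow>
    rec_in X n (\<lambda>xs. LEAST y. g (y # xs) = 0)"
| cong: "rec_in X n f \<Longrightarrow> (\<forall>xs. length xs = n \<longrightarrow> f xs = g xs) \<Longrightarrow> rec_in X n g"

definition computes_set :: "nat set \<Rightarrow> nat set \<Rightarrow> bool" where
  "computes_set X Y \<longleftrightarrow> rec_in X 1 (\<lambda>xs. of_bool (xs ! 0 \<in> Y))"

definition computes_rel :: "nat set \<Rightarrow> nat rel \<Rightarrow> bool" where
  "computes_rel X r \<longleftrightarrow> rec_in X 2 (\<lambda>xs. of_bool ((xs ! 0, xs ! 1) \<in> r))"

text \<open>
  The relation \<open>=o\<close> includes that both sides are (reflexive) well-orders, each on its own field.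
\<close>

definition computable_ordinal :: "nat set \<Rightarrow> cord \<Rightarrow> bool" where
  "computable_ordinal X \<alpha> \<longleftrightarrow>
    (\<exists>r. computes_rel X r \<and> r =o {(\<beta>, \<gamma>). \<beta> \<le> \<gamma> \<and> \<gamma> < \<alpha>})"

definition omega1_CK :: "nat set \<Rightarrow> cord" where
  "omega1_CK X = (LEAST \<alpha>. \<not> computable_ordinal X \<alpha>)"

subsection \<open>Vocabularies and structures\<close>

text \<open>
  Symbols are natural numbers, i.e. a countable vocabulary comes with a fixed numbering, as is
  needed to speak of computing a structure.  Constants are function symbols of arity \<open>0\<close>.
\<close>

record vocabulary =
  rels :: "nat set"
  funs :: "nat set"
  rel_arity :: "nat \<Rightarrow> nat"
  fun_arity :: "nat \<Rightarrow> nat"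

record 'a struct =
  univ :: "'a set"
  rel :: "nat \<Rightarrow> 'a list \<Rightarrow> bool"
  func :: "nat \<Rightarrow> 'a list \<Rightarrow> 'a"

definition is_structure :: "vocabulary \<Rightarrow> 'a struct \<Rightarrow> bool" where
  "is_structure L A \<longleftrightarrow> univ A \<noteq> {} \<and>
    (\<forall>f\<in>funs L. \<forall>as\<in>lists (univ A). length as = fun_arity L f \<longrightarrow> func A f as \<in> univ A)"

definition isomorphism :: "vocabulary \<Rightarrow> 'a struct \<Rightarrow> 'b struct \<Rightarrow> ('a \<Rightarrow> 'b) \<Rightarrow> bool" where
  "isomorphism L A B h \<longleftrightarrow> bij_betw h (univ A) (univ B) \<and>
    (\<forall>R\<in>rels L. \<forall>as\<in>lists (univ A). length as = rel_arity L R \<longrightarrow>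
      (rel A R as \<longleftrightarrow> rel B R (map h as))) \<and>
    (\<forall>f\<in>funs L. \<forall>as\<in>lists (univ A). length as = fun_arity L f \<longrightarrow>
      h (func A f as) = func B f (map h as))"

definition automorphic :: "vocabulary \<Rightarrow> 'a struct \<Rightarrow> 'a list \<Rightarrow> 'a list \<Rightarrow> bool" where
  "automorphic L A as bs \<longleftrightarrow> (\<exists>h. isomorphism L A A h \<and> map h as = bs)"

subsection \<open>Formulas\<close>

datatype tm = Var nat | Fn nat "tm list"

datatype atm = Eq tm tm | Rl nat "tm list"

text \<open>
  Formulas of \<open>L\<^bsub>\<omega>\<^sub>1\<omega>\<^esub>\<close>; the remaining connectives and quantifiers are definable.
\<close>

datatype fm = Atom atm | Neg fm | And fm fm | BigAnd "nat \<Rightarrow> fm" | Ex nat fm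

primrec wf_tm :: "vocabulary \<Rightarrow> tm \<Rightarrow> bool" where
  "wf_tm L (Var i) \<longleftrightarrow> True"
| "wf_tm L (Fn f ts) \<longleftrightarrow> f \<in> funs L \<and> length ts = fun_arity L f \<and> list_all id (map (wf_tm L) ts)"

primrec wf_atm :: "vocabulary \<Rightarrow> atm \<Rightarrow> bool" where
  "wf_atm L (Eq t u) \<longleftrightarrow> wf_tm L t \<and> wf_tm L u"
| "wf_atm L (Rl R ts) \<longleftrightarrow> R \<in> rels L \<and> length ts = rel_arity L R \<and> (\<forall>t\<in>set ts. wf_tm L t)"

primrec wf_fm :: "vocabulary \<Rightarrow> fm \<Rightarrow> bool" where
  "wf_fm L (Atom p) \<longleftrightarrow> wf_atm L p"
| "wf_fm L (Neg \<phi>) \<longleftrightarrow> wf_fm L \<phi>"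
| "wf_fm L (And \<phi> \<psi>) \<longleftrightarrow> wf_fm L \<phi> \<and> wf_fm L \<psi>"
| "wf_fm L (BigAnd F) \<longleftrightarrow> (\<forall>i. wf_fm L (F i))"
| "wf_fm L (Ex x \<phi>) \<longleftrightarrow> wf_fm L \<phi>"

primrec fv_tm :: "tm \<Rightarrow> nat set" where
  "fv_tm (Var i) = {i}"
| "fv_tm (Fn f ts) = \<Union> (set (map fv_tm ts))"

primrec fv_atm :: "atm \<Rightarrow> nat set" where
  "fv_atm (Eq t u) = fv_tm t \<union> fv_tm u"
| "fv_atm (Rl R ts) = (\<Union>t\<in>set ts. fv_tm t)"

primrec fv :: "fm \<Rightarrow> nat set" where
  "fv (Atom p) = fv_atm p"
| "fv (Neg \<phi>) = fv \<phi>"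
| "fv (And \<phi> \<psi>) = fv \<phi> \<union> fv \<psi>"
| "fv (BigAnd F) = (\<Union>i. fv (F i))"
| "fv (Ex x \<phi>) = fv \<phi> - {x}"

primrec tm_val :: "'a struct \<Rightarrow> (nat \<Rightarrow> 'a) \<Rightarrow> tm \<Rightarrow> 'a" where
  "tm_val A s (Var i) = s i"
| "tm_val A s (Fn f ts) = func A f (map (tm_val A s) ts)"

primrec sat_atm :: "'a struct \<Rightarrow> (nat \<Rightarrow> 'a) \<Rightarrow> atm \<Rightarrow> bool" where
  "sat_atm A s (Eq t u) \<longleftrightarrow> tm_val A s t = tm_val A s u"
| "sat_atm A s (Rl R ts) \<longleftrightarrow> rel A R (map (tm_val A s) ts)"

primrec sat :: "'a struct \<Rightarrow> fm \<Rightarrow> (nat \<Rightarrow> 'a) \<Rightarrow> bool" where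
  "sat A (Atom p) = (\<lambda>s. sat_atm A s p)"
| "sat A (Neg \<phi>) = (\<lambda>s. \<not> sat A \<phi> s)"
| "sat A (And \<phi> \<psi>) = (\<lambda>s. sat A \<phi> s \<and> sat A \<psi> s)"
| "sat A (BigAnd F) = (\<lambda>s. \<forall>i. sat A (F i) s)"
| "sat A (Ex x \<phi>) = (\<lambda>s. \<exists>c\<in>univ A. sat A \<phi> (s(x := c)))"

primrec open_fm :: "fm \<Rightarrow> bool" where
  "open_fm (Atom p) \<longleftrightarrow> True"
| "open_fm (Neg \<phi>) \<longleftrightarrow> open_fm \<phi>"
| "open_fm (And \<phi> \<psi>) \<longleftrightarrow> open_fm \<phi> \<and> open_fm \<psi>"
| "open_fm (BigAnd F) \<longleftrightarrow> False"
| "open_fm (Ex x \<phi>) \<longleftrightarrow> False"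

text \<open>
  A formula about an \<open>n\<close>-tuple has its free variables among \<open>0, \<dots>, n - 1\<close>, with variable \<open>i\<close>
  denoting the \<open>i\<close>-th entry; the values of \<open>(!) as\<close> from \<open>length as\<close> on are therefore irrelevant.
\<close>

definition same_atomic_type :: "vocabulary \<Rightarrow> 'a struct \<Rightarrow> 'a list \<Rightarrow> 'a list \<Rightarrow> bool" where
  "same_atomic_type L A as bs \<longleftrightarrow> length as = length bs \<and>
    (\<forall>p. wf_atm L p \<and> fv_atm p \<subseteq> {..<length as} \<longrightarrow>
      (sat_atm A ((!) as) p \<longleftrightarrow> sat_atm A ((!) bs) p))"

definition same_open_fms :: "vocabulary \<Rightarrow> 'a struct \<Rightarrow> 'a list \<Rightarrow> 'a list \<Rightarrow> bool" where
  "same_open_fms L A as bs \<longleftrightarrow> length as = length bs \<and>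
    (\<forall>\<phi>. wf_fm L \<phi> \<and> open_fm \<phi> \<and> fv \<phi> \<subseteq> {..<length as} \<longrightarrow>
      (sat A \<phi> ((!) as) \<longleftrightarrow> sat A \<phi> ((!) bs)))"

definition same_fms :: "vocabulary \<Rightarrow> 'a struct \<Rightarrow> 'a list \<Rightarrow> 'a list \<Rightarrow> bool" where
  "same_fms L A as bs \<longleftrightarrow> length as = length bs \<and>
    (\<forall>\<phi>. wf_fm L \<phi> \<and> fv \<phi> \<subseteq> {..<length as} \<longrightarrow>
      (sat A \<phi> ((!) as) \<longleftrightarrow> sat A \<phi> ((!) bs)))"

subsection \<open>Computing a copy of a structure\<close>

primrec tm_code :: "tm \<Rightarrow> nat" where
  "tm_code (Var i) = sum_encode (Inl i)"
| "tm_code (Fn f ts) = sum_encode (Inr (prod_encode (f, list_encode (map tm_code ts))))"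

primrec atm_code :: "atm \<Rightarrow> nat" where
  "atm_code (Eq t u) = sum_encode (Inl (prod_encode (tm_code t, tm_code u)))"
| "atm_code (Rl R ts) = sum_encode (Inr (prod_encode (R, list_encode (map tm_code ts))))"

text \<open>
  The atomic diagram of a structure \<open>B\<close> with universe a set of natural numbers: the codes of the
  atomic and negated atomic sentences, with a name for each element, that are true in \<open>B\<close>.
  The term \<open>Var b\<close> is used as the name of the element \<open>b\<close>.
\<close>

definition diagram :: "vocabulary \<Rightarrow> nat struct \<Rightarrow> nat set" where
  "diagram L B =
    {sum_encode (Inl (atm_code p)) | p. wf_atm L p \<and> fv_atm p \<subseteq> univ B \<and> sat_atm B id p} \<union>
    {sum_encode (Inr (atm_code p)) | p. wf_atm L p \<and> fv_atm p \<subseteq> univ B \<and> \<not> sat_atm B id p}"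

definition computes_copy :: "vocabulary \<Rightarrow> nat set \<Rightarrow> 'a struct \<Rightarrow> bool" where
  "computes_copy L X A \<longleftrightarrow>
    (\<exists>B :: nat struct. is_structure L B \<and> (\<exists>h. isomorphism L A B h) \<and> computes_set X (diagram L B))"

definition omega1 :: "vocabulary \<Rightarrow> 'a struct \<Rightarrow> cord" where
  "omega1 L A = (LEAST \<alpha>. \<exists>X. computes_copy L X A \<and> \<alpha> = omega1_CK X)"

subsection \<open>The two Scott ranks\<close>

function sim :: "vocabulary \<Rightarrow> 'a struct \<Rightarrow> cord \<Rightarrow> 'a list \<Rightarrow> 'a list \<Rightarrow> bool" where
  "sim L A \<alpha> as bs \<longleftrightarrow>
    as \<in> lists (univ A) \<and> bs \<in> lists (univ A) \<and> length as = length bs \<and>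
    (if \<alpha> = 0 then same_atomic_type L A as bs
     else if \<exists>\<beta>. \<alpha> = osuc \<beta> then
       (\<forall>\<beta>. \<alpha> = osuc \<beta> \<longrightarrow>
          (\<forall>c\<in>univ A. \<exists>d\<in>univ A. sim L A \<beta> (as @ [c]) (bs @ [d])) \<and>
          (\<forall>d\<in>univ A. \<exists>c\<in>univ A. sim L A \<beta> (as @ [c]) (bs @ [d])))
     else (\<forall>\<beta><\<alpha>. sim L A \<beta> as bs))"
  by pat_completeness auto
termination
  by (relation "inv_image {(\<beta>, \<alpha>). \<beta> < \<alpha>} (\<lambda>(L, A, \<alpha>, as, bs). \<alpha>)")
    (auto intro: wf less_osuc)

declare sim.simps [simp del]

function simAK :: "vocabulary \<Rightarrow> 'a struct \<Rightarrow> cord \<Rightarrow> 'a list \<Rightarrow> 'a list \<Rightarrow> bool" where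
  "simAK L A \<beta> as bs \<longleftrightarrow>
    as \<in> lists (univ A) \<and> bs \<in> lists (univ A) \<and> length as = length bs \<and>
    (if \<beta> = 0 then same_open_fms L A as bs
     else (\<forall>\<gamma><\<beta>.
       (\<forall>cs\<in>lists (univ A). \<exists>ds\<in>lists (univ A).
          length cs = length ds \<and> simAK L A \<gamma> (as @ cs) (bs @ ds)) \<and>
       (\<forall>ds\<in>lists (univ A). \<exists>cs\<in>lists (univ A).
          length cs = length ds \<and> simAK L A \<gamma> (as @ cs) (bs @ ds))))"
  by pat_completeness auto
termination
  by (relation "inv_image {(\<beta>, \<alpha>). \<beta> < \<alpha>} (\<lambda>(L, A, \<alpha>, as, bs). \<alpha>)")
    (auto intro: wf)

declare simAK.simps [simp del]

text \<open>
  For countable structures the \<open>LEAST\<close> in \<open>rho_sim\<close> and \<open>rho_AK\<close> ranges over a nonempty set of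
  countable ordinals, by Scott's analysis, and the suprema are over countable sets.
\<close>

definition rho_sim :: "vocabulary \<Rightarrow> 'a struct \<Rightarrow> 'a list \<Rightarrow> cord" where
  "rho_sim L A as = (LEAST \<alpha>. \<forall>bs\<in>lists (univ A). sim L A \<alpha> as bs \<longrightarrow> automorphic L A as bs)"

definition SR_sim :: "vocabulary \<Rightarrow> 'a struct \<Rightarrow> cord" where
  "SR_sim L A = osup {osuc (rho_sim L A as) | as. as \<in> lists (univ A)}"

definition rho_AK :: "vocabulary \<Rightarrow> 'a struct \<Rightarrow> 'a list \<Rightarrow> cord" where
  "rho_AK L A as = (LEAST \<beta>. \<forall>bs\<in>lists (univ A). simAK L A \<beta> as bs \<longrightarrow> same_fms L A as bs)"

definition SR_AK :: "vocabulary \<Rightarrow> 'a struct \<Rightarrow> cord" where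
  "SR_AK L A = osup {osuc (rho_AK L A as) | as. as \<in> lists (univ A)}"

unbundle no cardinal_syntax

end

theory Submission
  imports Defs "HOL-Library.Product_Lexorder"
begin

text \<open>
  By Scott's theorem, tuples of a countable structure satisfy the same formulas iff they are
  automorphic.  Since \<open>simAK \<alpha>\<close> implies \<open>sim \<alpha>\<close>, and \<open>sim (\<omega> \<cdot> \<alpha>)\<close> implies \<open>simAK \<alpha>\<close> (an
  \<open>n\<close>-tuple is played as \<open>n\<close> single moves), every tuple has
  \<open>rho_AK \<le> rho_sim \<le> \<omega> \<cdot> rho_AK\<close>.  Now \<open>omega1 L A\<close> is some \<open>omega1_CK X\<close>, hence a limit closed
  under \<open>\<alpha> \<mapsto> \<omega> \<cdot> \<alpha>\<close>, because from an \<open>X\<close>-computable order of type \<open>\<alpha>\<close> one computes an order of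
  type \<open>\<omega> \<cdot> \<alpha>\<close>.  So the two ranks of a tuple are below \<open>omega1 L A\<close>, or at most \<open>omega1 L A\<close>, at
  the same time.
\<close>

subsection \<open>Ordinals\<close>

text \<open>Write \<Omega> for \<open>omega1 L A\<close>. Equality of a Scott rank with \<Omega> or
  \<Omega> + 1 is a Boolean combination of "at least \<Omega>", "at most \<Omega>" and "at most
  \<Omega> + 1", so these are what is compared. The last two can be checked tuple by tuple. The
  first cannot: the ranks of the tuples could all lie below \<Omega> and still have supremum
  \<Omega>. So a bound \<alpha> < \<Omega> on all \<open>rho_AK\<close> has to yield a single
  \<delta> < \<Omega> bounding all \<open>rho_sim\<close>, which is why one computable order has to
  accommodate \<omega> \<cdot> \<gamma> for all \<gamma> < \<alpha> together. Tuples of rank exactly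
  \<Omega> need the fixed point \<omega> \<cdot> \<Omega> = \<Omega>. Ordinal multiplication is
  never defined. Its place is taken by a doubly indexed family of ordinals, ordered like \<omega>
  \<cdot> \<gamma> + n, and order types are compared through strictly increasing maps.\<close>

lemma osuc_le_iff: "osuc \<alpha> \<le> \<beta> \<longleftrightarrow> \<alpha> < \<beta>"
  using less_osuc[of \<alpha>] Least_le[of "\<lambda>\<beta>. \<alpha> < \<beta>" \<beta>] unfolding osuc_def by auto

lemma less_osuc_iff: "\<beta> < osuc \<alpha> \<longleftrightarrow> \<beta> \<le> \<alpha>"
  using osuc_le_iff[of \<alpha> \<beta>] by (auto simp flip: not_le)

lemma osuc_inject [simp]: "osuc \<alpha> = osuc \<beta> \<longleftrightarrow> \<alpha> = \<beta>"
  by (metis less_osuc_iff less_osuc order_antisym)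

lemma zero_le_cord [simp]: "(0::cord) \<le> \<alpha>"
  unfolding zero_cord_def by (rule Least_le) simp

lemma osuc_neq_zero [simp]: "osuc \<alpha> \<noteq> 0"
  by (metis less_osuc not_less zero_le_cord)

text \<open>A counterexample \<gamma> would give f (f \<gamma>) < f \<gamma> < \<gamma>, against the
  induction hypothesis at f \<gamma>. The lemma serves to compare order types: a strictly increasing
  map of \<alpha> into \<beta> rules out \<beta> < \<alpha>.\<close>

lemma le_strict_mono_cord:
  fixes f :: "cord \<Rightarrow> cord"
  assumes "\<And>\<beta> \<gamma>. \<beta> < \<gamma> \<Longrightarrow> \<gamma> < \<alpha> \<Longrightarrow> f \<beta> < f \<gamma>" and "\<gamma> < \<alpha>"
  shows "\<gamma> \<le> f \<gamma>"
  using assms(2)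
proof (induction \<gamma> rule: less_induct)
  case (less \<gamma>)
  show ?case
  proof (rule ccontr)
    assume "\<not> \<gamma> \<le> f \<gamma>"
    then have *: "f \<gamma> < \<gamma>" by simp
    then have "f \<gamma> \<le> f (f \<gamma>)" "f (f \<gamma>) < f \<gamma>"
      using less assms(1) by (auto intro: less.IH order.strict_trans)
    then show False by simp
  qed
qed

text \<open>The Mostowski collapse of the well-order that \<open>\<kappa>\<close> induces on \<open>S\<close>.\<close>

function collapse :: "(nat \<Rightarrow> 'b::wellorder) \<Rightarrow> nat set \<Rightarrow> 'b \<Rightarrow> cord" where
  "collapse \<kappa> S b = (LEAST \<gamma>. \<forall>u\<in>S. \<kappa> u < b \<longrightarrow> collapse \<kappa> S (\<kappa> u) < \<gamma>)"
  by pat_completeness auto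
termination
  by (relation "inv_image {(b, c). b < c} (\<lambda>(\<kappa>, S, b). b)") (auto intro: wf)

declare collapse.simps [simp del]

text \<open>Ranks defined as least strict upper bounds of earlier ranks increase strictly and skip
  no ordinal. The bounds exist in \<open>cord\<close> because \<open>S\<close>, a set of naturals,
  is countable; injectivity of \<open>\<kappa>\<close> makes comparison of labels antisymmetric on
  \<open>S\<close>.\<close>

lemma ex_collapse:
  fixes \<kappa> :: "nat \<Rightarrow> 'b::wellorder"
  assumes inj: "inj_on \<kappa> S"
  shows "\<exists>g (\<delta>::cord). bij_betw g S {..<\<delta>} \<and> (\<forall>u\<in>S. \<forall>v\<in>S. g u \<le> g v \<longleftrightarrow> \<kappa> u \<le> \<kappa> v)"
proof -
  define g where "g u = collapse \<kappa> S (\<kappa> u)" for u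
  define \<delta> where "\<delta> = (LEAST \<gamma>. \<forall>u\<in>S. g u < \<gamma>)"
  have bdd: "\<exists>\<gamma>. \<forall>u\<in>S. P u \<longrightarrow> g u < \<gamma>" for P
    using countable_cord_bounded[of "g ` S"] by auto
  have mono: "g u < g v" if "u \<in> S" "\<kappa> u < \<kappa> v" for u v
    using LeastI_ex[OF bdd[of "\<lambda>u. \<kappa> u < \<kappa> v"]] that
    unfolding g_def by (subst (2) collapse.simps) auto
  have below: "g u < \<delta>" if "u \<in> S" for u
    using LeastI_ex[OF bdd[of "\<lambda>_. True"]] that unfolding \<delta>_def by auto
  have ex: "\<exists>v\<in>S. \<kappa> v < \<kappa> u \<and> \<gamma> \<le> g v" if "\<gamma> < g u" for \<gamma> u
    using that not_less_Least[of \<gamma> "\<lambda>\<gamma>. \<forall>v\<in>S. \<kappa> v < \<kappa> u \<longrightarrow> g v < \<gamma>"]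
    unfolding g_def by (subst (asm) collapse.simps) (auto simp: not_less)
  have onto: "\<gamma> \<in> g ` S" if "\<gamma> < \<delta>" for \<gamma>
  proof -
    have "\<exists>b. \<exists>u\<in>S. b = \<kappa> u \<and> \<gamma> \<le> g u"
      using that not_less_Least[of \<gamma> "\<lambda>\<gamma>. \<forall>u\<in>S. g u < \<gamma>"] unfolding \<delta>_def
      by (auto simp: not_less)
    \<comment> \<open>Let \<open>u\<close> have the least label among the points of rank at least
      \<gamma>. If its rank exceeded \<gamma>, \<open>ex\<close> would give such a point with a
      smaller label.\<close>
    then obtain u where u: "u \<in> S" "\<gamma> \<le> g u"
      and least: "\<And>v. v \<in> S \<Longrightarrow> \<gamma> \<le> g v \<Longrightarrow> \<kappa> u \<le> \<kappa> v"
      using exists_least_iff[of "\<lambda>b. \<exists>u\<in>S. b = \<kappa> u \<and> \<gamma> \<le> g u"] by (metis not_le)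
    have "\<not> \<gamma> < g u"
      using ex[of \<gamma> u] least by (metis not_le)
    with u show ?thesis by auto
  qed
  have le: "g u \<le> g v \<longleftrightarrow> \<kappa> u \<le> \<kappa> v" if "u \<in> S" "v \<in> S" for u v
    using mono[of u v] mono[of v u] that inj_onD[OF inj, of u v]
    by (cases "\<kappa> u" "\<kappa> v" rule: linorder_cases) auto
  moreover have "inj_on g S"
    using le inj by (metis inj_on_def order_antisym order_refl)
  then have "bij_betw g S {..<\<delta>}"
    using onto below by (auto simp: bij_betw_def)
  ultimately show ?thesis
    by blast
qed

lemma Well_order_pullback:
  fixes \<kappa> :: "'a \<Rightarrow> 'b::wellorder"
  assumes "inj_on \<kappa> S"
  shows "Well_order {(u, v). u \<in> S \<and> v \<in> S \<and> \<kappa> u \<le> \<kappa> v}" (is "Well_order ?r")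
    and "Field {(u, v). u \<in> S \<and> v \<in> S \<and> \<kappa> u \<le> \<kappa> v} = S"
proof -
  show F: "Field ?r = S" by (auto simp: Field_def)
  have "wf (?r - Id)"
    by (rule wf_subset[OF wf_inv_image[OF wf, of \<kappa>]])
      (use assms in \<open>auto simp: inv_image_def inj_on_def le_less\<close>)
  moreover have "total_on S ?r" "refl_on S ?r" "trans ?r"
    by (auto simp: total_on_def refl_on_def trans_def)
  moreover have "antisym ?r"
    using assms by (auto simp: antisym_def inj_on_def)
  ultimately show "Well_order ?r"
    unfolding F well_order_on_def linear_order_on_def partial_order_on_def preorder_on_def
    by auto
qed

subsection \<open>Recursive functions\<close>

named_theorems rec_intros

declare rec_in.zero [rec_intros] rec_in.proj [rec_intros]

text \<open>Composition with \<open>g\<close> acting on numbers instead of lists. Closure rules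
  derived in this form can be applied along the syntax of a function, which is how
  \<open>rec_intros\<close> is used.\<close>

lemma rec_in_comp1:
  assumes "rec_in X 1 (\<lambda>xs. g (xs ! 0))" "rec_in X n f"
  shows "rec_in X n (\<lambda>xs. g (f xs))"
  using rec_in.comp[of X "[f]" "\<lambda>xs. g (xs ! 0)" n] assms by simp

lemma rec_in_comp2:
  assumes "rec_in X 2 (\<lambda>xs. g (xs ! 0) (xs ! 1))" "rec_in X n f1" "rec_in X n f2"
  shows "rec_in X n (\<lambda>xs. g (f1 xs) (f2 xs))"
  using rec_in.comp[of X "[f1, f2]" "\<lambda>xs. g (xs ! 0) (xs ! 1)" n] assms
  by (simp add: numeral_2_eq_2)

lemma rec_in_Suc [rec_intros]: "rec_in X n f \<Longrightarrow> rec_in X n (\<lambda>xs. Suc (f xs))"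
  by (rule rec_in_comp1[OF rec_in.succ])

lemma rec_in_const [rec_intros]: "rec_in X n (\<lambda>_. k)"
  by (induction k) (rule rec_in.zero, rule rec_in_Suc)

lemma rec_in_pred [rec_intros]: "rec_in X n f \<Longrightarrow> rec_in X n (\<lambda>xs. f xs - 1)"
proof (rule rec_in_comp1[where g = "\<lambda>m. m - 1"])
  have "rec_in X 1 (\<lambda>xs. rec_nat ((\<lambda>_. 0) (tl xs)) (\<lambda>k r. (\<lambda>ys. ys ! 0) (k # r # tl xs)) (hd xs))"
    unfolding One_nat_def by (intro rec_in.prec rec_intros) auto
  moreover have "rec_nat (0::nat) (\<lambda>k r. k) m = m - 1" for m
    by (cases m) auto
  ultimately show "rec_in X 1 (\<lambda>xs. xs ! 0 - 1)"
    by (elim rec_in.cong) (auto simp: length_Suc_conv)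
qed

lemma rec_in_add [rec_intros]:
  "rec_in X n f \<Longrightarrow> rec_in X n g \<Longrightarrow> rec_in X n (\<lambda>xs. f xs + g xs)"
proof (rule rec_in_comp2[where g = "(+)"])
  have "rec_in X 2 (\<lambda>xs. rec_nat ((\<lambda>ys. ys ! 0) (tl xs))
      (\<lambda>k r. (\<lambda>ys. Suc (ys ! 1)) (k # r # tl xs)) (hd xs))"
    unfolding numeral_2_eq_2 by (intro rec_in.prec rec_intros) auto
  moreover have "rec_nat a (\<lambda>k r. Suc r) m = m + a" for m a :: nat
    by (induction m) auto
  ultimately show "rec_in X 2 (\<lambda>xs. xs ! 0 + xs ! 1)"
    by (elim rec_in.cong) (auto simp: length_Suc_conv numeral_2_eq_2)
qed

lemma rec_in_mult [rec_intros]: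
  "rec_in X n f \<Longrightarrow> rec_in X n g \<Longrightarrow> rec_in X n (\<lambda>xs. f xs * g xs)"
proof (rule rec_in_comp2[where g = "(*)"])
  have "rec_in X 2 (\<lambda>xs. rec_nat ((\<lambda>_. 0) (tl xs))
      (\<lambda>k r. (\<lambda>ys. ys ! 1 + ys ! 2) (k # r # tl xs)) (hd xs))"
    unfolding numeral_2_eq_2 by (intro rec_in.prec rec_intros) auto
  moreover have "rec_nat 0 (\<lambda>k r. r + a) m = m * a" for m a :: nat
    by (induction m) auto
  ultimately show "rec_in X 2 (\<lambda>xs. xs ! 0 * xs ! 1)"
    by (elim rec_in.cong) (auto simp: length_Suc_conv numeral_2_eq_2)
qed

lemma rec_in_diff [rec_intros]:
  assumes "rec_in X n f" "rec_in X n g"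
  shows "rec_in X n (\<lambda>xs. f xs - g xs)"
proof -
  have "rec_in X 2 (\<lambda>xs. rec_nat ((\<lambda>ys. ys ! 0) (tl xs))
      (\<lambda>k r. (\<lambda>ys. ys ! 1 - 1) (k # r # tl xs)) (hd xs))"
    unfolding numeral_2_eq_2 by (intro rec_in.prec rec_intros) auto
  moreover have "rec_nat a (\<lambda>k r. r - Suc 0) m = a - m" for m a :: nat
    by (induction m) auto
  \<comment> \<open>Primitive recursion runs on the first argument, which is therefore the
    subtrahend; \<open>rec_in_comp2\<close> then restores the order.\<close>
  ultimately have "rec_in X 2 (\<lambda>xs. xs ! 1 - xs ! 0)"
    by (elim rec_in.cong) (auto simp: length_Suc_conv numeral_2_eq_2)
  then show ?thesis
    by (rule rec_in_comp2[where g = "\<lambda>b a. a - b"]) (fact assms)+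
qed

lemma rec_in_is_zero [rec_intros]:
  assumes "rec_in X n f"
  shows "rec_in X n (\<lambda>xs. of_bool (f xs = 0))"
  by (rule rec_in.cong[OF rec_in_diff[OF rec_in_const[of _ _ 1] assms]]) auto

lemma rec_in_not [rec_intros]:
  assumes "rec_in X n (\<lambda>xs. of_bool (P xs))"
  shows "rec_in X n (\<lambda>xs. of_bool (\<not> P xs))"
  by (rule rec_in.cong[OF rec_in_is_zero[OF assms]]) auto

lemma rec_in_conj [rec_intros]:
  assumes "rec_in X n (\<lambda>xs. of_bool (P xs))" "rec_in X n (\<lambda>xs. of_bool (Q xs))"
  shows "rec_in X n (\<lambda>xs. of_bool (P xs \<and> Q xs))"
  by (rule rec_in.cong[OF rec_in_mult[OF assms]]) auto

lemma rec_in_disj [rec_intros]: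
  assumes "rec_in X n (\<lambda>xs. of_bool (P xs))" "rec_in X n (\<lambda>xs. of_bool (Q xs))"
  shows "rec_in X n (\<lambda>xs. of_bool (P xs \<or> Q xs))"
  using rec_in_not[OF rec_in_conj[OF assms[THEN rec_in_not]]] by simp

lemma rec_in_le [rec_intros]:
  assumes "rec_in X n f" "rec_in X n g"
  shows "rec_in X n (\<lambda>xs. of_bool (f xs \<le> g xs))"
  using rec_in_is_zero[OF rec_in_diff[OF assms]] by simp

lemma rec_in_rel:
  assumes "computes_rel X r" "rec_in X n f" "rec_in X n g"
  shows "rec_in X n (\<lambda>xs. of_bool ((f xs, g xs) \<in> r))"
  using rec_in_comp2[of X "\<lambda>u v. of_bool ((u, v) \<in> r)"] assms unfolding computes_rel_def by blast

section \<open>Counting the relations recursive in an oracle\<close>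

datatype rcode = Zero | Succ | Proj nat | Orac | Comp rcode "rcode list" | Prec rcode rcode | Mini rcode

instance rcode :: countable
  by countable_datatype

text \<open>An interpreter without arity or regularity checks, hence total: a minimization that
  finds no zero has an unspecified value. Codes may denote more than the recursive functions, but to
  count the latter it suffices that each of them has a code.\<close>

primrec run :: "nat set \<Rightarrow> rcode \<Rightarrow> nat list \<Rightarrow> nat" where
  "run X Zero = (\<lambda>_. 0)"
| "run X Succ = (\<lambda>xs. Suc (xs ! 0))"
| "run X (Proj i) = (\<lambda>xs. xs ! i)"
| "run X Orac = (\<lambda>xs. of_bool (xs ! 0 \<in> X))"
| "run X (Comp g hs) = (\<lambda>xs. run X g (map (\<lambda>h. h xs) (map (run X) hs)))"
| "run X (Prec g h) =
    (\<lambda>xs. rec_nat (run X g (tl xs)) (\<lambda>k r. run X h (k # r # tl xs)) (hd xs))"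
| "run X (Mini g) = (\<lambda>xs. LEAST y. run X g (y # xs) = 0)"

lemma rec_in_imp_run:
  assumes "rec_in X n f"
  shows "\<exists>c. \<forall>xs. length xs = n \<longrightarrow> f xs = run X c xs"
  using assms
proof induction
  case (zero n)
  show ?case by (rule exI[of _ Zero]) simp
next
  case succ
  show ?case by (rule exI[of _ Succ]) simp
next
  case (proj i n)
  show ?case by (rule exI[of _ "Proj i"]) simp
next
  case orac
  show ?case by (rule exI[of _ Orac]) simp
next
  case (comp hs g n)
  obtain c where c: "\<And>xs. length xs = length hs \<Longrightarrow> g xs = run X c xs"
    using comp.IH by blast
  obtain d where d: "\<And>h xs. h \<in> set hs \<Longrightarrow> length xs = n \<Longrightarrow> h xs = run X (d h) xs"
    using comp.IH by metis
  have "g (map (\<lambda>h. h xs) hs) = run X (Comp c (map d hs)) xs" if "length xs = n" for xs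
  proof -
    have "map (\<lambda>h. h xs) hs = map (\<lambda>h. run X (d h) xs) hs"
      using d that by simp
    then show ?thesis by (simp add: c comp_def del: map_eq_conv)
  qed
  then show ?case by blast
next
  case (prec n g h)
  then obtain c d where c: "\<And>xs. length xs = n \<Longrightarrow> g xs = run X c xs"
    and d: "\<And>xs. length xs = Suc (Suc n) \<Longrightarrow> h xs = run X d xs"
    by blast
  show ?case
    by (rule exI[of _ "Prec c d"]) (simp add: c d)
next
  case (mini n g)
  then obtain c where c: "\<And>xs. length xs = Suc n \<Longrightarrow> g xs = run X c xs"
    by blast
  show ?case
    by (rule exI[of _ "Mini c"]) (simp add: c)
next
  case (cong n f g)
  then show ?case by metis
qed

lemma countable_computes_rel: "countable {r. computes_rel X r}"
proof -
  have "{r. computes_rel X r} \<subseteq> (\<lambda>c. {(u, v). run X c [u, v] = 1}) ` UNIV"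
  proof
    fix r assume "r \<in> {r. computes_rel X r}"
    then obtain c where c: "\<And>xs. length xs = 2 \<Longrightarrow> of_bool ((xs ! 0, xs ! 1) \<in> r) = run X c xs"
      using rec_in_imp_run unfolding computes_rel_def by blast
    have "r = {(u, v). run X c [u, v] = 1}"
    proof (intro set_eqI, clarify)
      fix u v show "(u, v) \<in> r \<longleftrightarrow> (u, v) \<in> {(u, v). run X c [u, v] = 1}"
        using c[of "[u, v]"] by (cases "(u, v) \<in> r") auto
    qed
    then show "r \<in> (\<lambda>c. {(u, v). run X c [u, v] = 1}) ` UNIV"
      by blast
  qed
  then show ?thesis
    by (rule countable_subset) simp
qed

subsection \<open>Computable ordinals\<close>

text \<open>Turns isomorphism types into labels that later constructions can manipulate: for a given
  computable relation, \<open>S\<close> is its field and \<open>g\<close> the isomorphism.\<close>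

lemma computable_ordinal_iff:
  "computable_ordinal X \<alpha> \<longleftrightarrow> (\<exists>S g. bij_betw g S {..<\<alpha>} \<and>
    computes_rel X {(u, v). u \<in> S \<and> v \<in> S \<and> g u \<le> g v})"
proof
  have eq: "{(\<beta>, \<gamma>). \<beta> \<le> \<gamma> \<and> \<gamma> < \<alpha>} = {(\<beta>, \<gamma>). \<beta> \<in> {..<\<alpha>} \<and> \<gamma> \<in> {..<\<alpha>} \<and> id \<beta> \<le> id \<gamma>}"
    by auto
  note wo = Well_order_pullback[of id "{..<\<alpha>}", folded eq, simplified]
  {
    assume "computable_ordinal X \<alpha>"
    then obtain r f where r: "computes_rel X r" and bij: "bij_betw f (Field r) {..<\<alpha>}"
      and iff: "\<And>u v. u \<in> Field r \<Longrightarrow> v \<in> Field r \<Longrightarrow> (u, v) \<in> r \<longleftrightarrow> f u \<le> f v \<and> f v < \<alpha>"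
      unfolding computable_ordinal_def ordIso_def iso_iff2 by (auto simp: wo)
    have "r = {(u, v). u \<in> Field r \<and> v \<in> Field r \<and> f u \<le> f v}"
      using iff bij_betwE[OF bij] by (auto intro: FieldI1 FieldI2)
    with r bij show "\<exists>S g. bij_betw g S {..<\<alpha>} \<and>
        computes_rel X {(u, v). u \<in> S \<and> v \<in> S \<and> g u \<le> g v}"
      by (intro exI[of _ "Field r"] exI[of _ f]) simp
  next
    assume "\<exists>S g. bij_betw g S {..<\<alpha>} \<and> computes_rel X {(u, v). u \<in> S \<and> v \<in> S \<and> g u \<le> g v}"
    then obtain S g where g: "bij_betw g S {..<\<alpha>}"
      and r: "computes_rel X {(u, v). u \<in> S \<and> v \<in> S \<and> g u \<le> g v}" (is "computes_rel X ?r")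
      by blast
    note wo' = Well_order_pullback[OF bij_betw_imp_inj_on[OF g]]
    have "iso ?r {(\<beta>, \<gamma>). \<beta> \<le> \<gamma> \<and> \<gamma> < \<alpha>} g"
      unfolding iso_iff2 wo' wo using g bij_betwE[OF g] by auto
    then show "computable_ordinal X \<alpha>"
      unfolding computable_ordinal_def ordIso_def using r wo wo' by blast
  }
qed

lemma computable_ordinal_less:
  assumes "computable_ordinal X \<alpha>" "\<beta> < \<alpha>"
  shows "computable_ordinal X \<beta>"
proof -
  obtain S g where g: "bij_betw g S {..<\<alpha>}"
    and r: "computes_rel X {(u, v). u \<in> S \<and> v \<in> S \<and> g u \<le> g v}"
    using assms(1) unfolding computable_ordinal_iff by blast
  define r where "r = {(u, v). u \<in> S \<and> v \<in> S \<and> g u \<le> g v}"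
  obtain p where p: "p \<in> S" "g p = \<beta>"
    using g assms(2) by (metis bij_betw_imp_surj_on imageE lessThan_iff)
  define T where "T = {u \<in> S. g u < \<beta>}"
  \<comment> \<open>The initial segment is decided by comparison with \<open>p\<close>, a fixed
    number built into the algorithm.\<close>
  have eq: "(u \<in> T \<and> v \<in> T \<and> g u \<le> g v) \<longleftrightarrow> (u, v) \<in> r \<and> (v, p) \<in> r \<and> (p, v) \<notin> r" for u v
    using p by (auto simp: r_def T_def)
  have "computes_rel X {(u, v). u \<in> T \<and> v \<in> T \<and> g u \<le> g v}"
    unfolding eq computes_rel_def mem_Collect_eq prod.case
    by (intro rec_in_rel[OF r[folded r_def]] rec_intros) auto
  moreover have "bij_betw g T {..<\<beta>}"
  proof (rule bij_betw_imageI)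
    show "inj_on g T"
      using g by (auto simp: bij_betw_def inj_on_def T_def)
    have "\<gamma> \<in> g ` T" if "\<gamma> < \<beta>" for \<gamma>
    proof -
      have "\<gamma> \<in> g ` S"
        using that assms(2) bij_betw_imp_surj_on[OF g] by simp
      with that show ?thesis by (auto simp: T_def)
    qed
    then show "g ` T = {..<\<beta>}" by (auto simp: T_def)
  qed
  ultimately show ?thesis
    unfolding computable_ordinal_iff by blast
qed

text \<open>Otherwise a choice of a computable relation for each \<alpha> would map the uncountable
  \<open>cord\<close> injectively into a countable set.\<close>

lemma ex_not_computable_ordinal: "\<exists>\<alpha>. \<not> computable_ordinal X \<alpha>"
proof (rule ccontr)
  assume "\<not> ?thesis"
  then have "\<forall>\<alpha>::cord. \<exists>S g. bij_betw g S {..<\<alpha>} \<and>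
      computes_rel X {(u, v). u \<in> S \<and> v \<in> S \<and> g u \<le> g v}"
    unfolding computable_ordinal_iff by simp
  from this[THEN choice] obtain S where "\<forall>\<alpha>::cord. \<exists>g. bij_betw g (S \<alpha>) {..<\<alpha>} \<and>
      computes_rel X {(u, v). u \<in> S \<alpha> \<and> v \<in> S \<alpha> \<and> g u \<le> g v}" ..
  from this[THEN choice] obtain g where g: "\<And>\<alpha>::cord. bij_betw (g \<alpha>) (S \<alpha>) {..<\<alpha>}"
    and r: "\<And>\<alpha>. computes_rel X {(u, v). u \<in> S \<alpha> \<and> v \<in> S \<alpha> \<and> g \<alpha> u \<le> g \<alpha> v}"
    by blast
  define r where "r \<alpha> = {(u, v). u \<in> S \<alpha> \<and> v \<in> S \<alpha> \<and> g \<alpha> u \<le> g \<alpha> v}" for \<alpha>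
  \<comment> \<open>One relation cannot have two order types: sending labels below \<alpha> to
    labels below \<beta> is a strictly increasing \<open>f\<close>, so \<beta> \<le> f \<beta> <
    \<beta>.\<close>
  have False if eq: "r \<alpha> = r \<beta>" and less: "\<beta> < \<alpha>" for \<alpha> \<beta>
  proof -
    have "u \<in> S \<gamma> \<longleftrightarrow> (u, u) \<in> r \<gamma>" for u \<gamma>
      by (auto simp: r_def)
    then have S: "S \<beta> = S \<alpha>"
      using eq by auto
    define f where "f \<gamma> = g \<beta> (inv_into (S \<alpha>) (g \<alpha>) \<gamma>)" for \<gamma>
    have inv: "inv_into (S \<alpha>) (g \<alpha>) \<gamma> \<in> S \<alpha>" "g \<alpha> (inv_into (S \<alpha>) (g \<alpha>) \<gamma>) = \<gamma>" if "\<gamma> < \<alpha>" for \<gamma>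
      using bij_betw_imp_surj_on[OF g, of \<alpha>] that by (auto simp: inv_into_into f_inv_into_f)
    have "g \<beta> u < g \<beta> v" if "u \<in> S \<alpha>" "v \<in> S \<alpha>" "g \<alpha> u < g \<alpha> v" for u v
    proof -
      have "(v, u) \<notin> r \<beta>"
        using that unfolding eq[symmetric] by (simp add: r_def)
      then show ?thesis
        using that by (simp add: r_def S)
    qed
    then have "\<gamma> \<le> f \<gamma>" if "\<gamma> < \<alpha>" for \<gamma>
      using that inv by (intro le_strict_mono_cord[of \<alpha>]) (auto simp: f_def)
    moreover have "f \<beta> < \<beta>"
      using bij_betwE[OF g[of \<beta>]] inv(1)[OF less] by (auto simp: f_def S)
    ultimately show False
      using less by fastforce
  qed
  then have "inj r"
    by (metis injI neqE)
  moreover have "countable (range r)"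
    by (rule countable_subset[OF _ countable_computes_rel[of X]]) (use r in \<open>auto simp: r_def\<close>)
  ultimately show False
    using uncountable_cord countable_image_inj_on by blast
qed

lemma computable_ordinal_iff_less: "computable_ordinal X \<alpha> \<longleftrightarrow> \<alpha> < omega1_CK X"
proof
  show "\<alpha> < omega1_CK X" if "computable_ordinal X \<alpha>"
    using LeastI_ex[OF ex_not_computable_ordinal[of X]] computable_ordinal_less[OF that] that
    unfolding omega1_CK_def by (metis linorder_neqE)
  show "computable_ordinal X \<alpha>" if "\<alpha> < omega1_CK X"
    using not_less_Least that unfolding omega1_CK_def by blast
qed

text \<open>Condenses the collapse to what lower bounds on \<open>omega1_CK X\<close> use, a
  strictly increasing map into some smaller \<delta>. Labels may come from any well-order; the
  applications take them in lexicographic products of \<open>nat\<close> and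
  \<open>cord\<close>.\<close>

lemma computable_collapse:
  fixes \<kappa> :: "nat \<Rightarrow> 'b::wellorder"
  assumes "inj_on \<kappa> S" and "computes_rel X {(u, v). u \<in> S \<and> v \<in> S \<and> \<kappa> u \<le> \<kappa> v}"
  obtains h :: "nat \<Rightarrow> cord" and \<delta> where "\<delta> < omega1_CK X" and "\<And>u. u \<in> S \<Longrightarrow> h u < \<delta>"
    and "\<And>u v. u \<in> S \<Longrightarrow> v \<in> S \<Longrightarrow> \<kappa> u < \<kappa> v \<Longrightarrow> h u < h v"
proof -
  obtain g and \<delta> :: cord where g: "bij_betw g S {..<\<delta>}"
    and le: "\<And>u v. u \<in> S \<Longrightarrow> v \<in> S \<Longrightarrow> g u \<le> g v \<longleftrightarrow> \<kappa> u \<le> \<kappa> v"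
    using ex_collapse[OF assms(1)] by blast
  have "{(u, v). u \<in> S \<and> v \<in> S \<and> \<kappa> u \<le> \<kappa> v} = {(u, v). u \<in> S \<and> v \<in> S \<and> g u \<le> g v}"
    using le by auto
  then have "\<delta> < omega1_CK X"
    using assms(2) g by (auto simp: computable_ordinal_iff simp flip: computable_ordinal_iff_less)
  then show thesis
    using bij_betwE[OF g] le by (intro that[of \<delta> g]) (auto simp flip: not_le)
qed

section \<open>Closure of \<open>omega1_CK X\<close> under successor and multiplication by
  \<omega>\<close>

lemma osuc_less_omega1_CK:
  assumes "\<alpha> < omega1_CK X"
  shows "osuc \<alpha> < omega1_CK X"
proof -
  obtain S g where g: "bij_betw g S {..<\<alpha>}"
    and r: "computes_rel X {(u, v). u \<in> S \<and> v \<in> S \<and> g u \<le> g v}"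
    using assms unfolding computable_ordinal_iff_less[symmetric] computable_ordinal_iff by blast
  define r where "r = {(u, v). u \<in> S \<and> v \<in> S \<and> g u \<le> g v}"
  \<comment> \<open>A new greatest point \<open>0\<close> on top of the old order, which is shifted by one.\<close>
  define \<kappa> :: "nat \<Rightarrow> nat \<times> cord" where "\<kappa> u = (if u = 0 then (1, 0) else (0, g (u - 1)))" for u
  define T where "T = insert 0 (Suc ` S)"
  have T: "u \<in> T \<longleftrightarrow> u = 0 \<or> u - 1 \<in> S" for u
    by (cases u) (auto simp: T_def)
  have "inj_on \<kappa> T"
    using g by (auto simp: inj_on_def \<kappa>_def T_def bij_betw_def)
  moreover have "computes_rel X {(u, v). u \<in> T \<and> v \<in> T \<and> \<kappa> u \<le> \<kappa> v}"
  proof -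
    \<comment> \<open>The diagonal pair \<open>(u - 1, u - 1)\<close> tests whether
      \<open>u - 1\<close> is in \<open>S\<close>; the case \<open>v = 0\<close> is comparison with
      the new top.\<close>
    have eq: "(u \<in> T \<and> v \<in> T \<and> \<kappa> u \<le> \<kappa> v) \<longleftrightarrow>
        u \<noteq> 0 \<and> v \<noteq> 0 \<and> (u - 1, v - 1) \<in> r \<or> v = 0 \<and> (u = 0 \<or> (u - 1, u - 1) \<in> r)" for u v
      by (auto simp: T \<kappa>_def r_def less_eq_prod_def)
    show ?thesis
      unfolding eq computes_rel_def mem_Collect_eq prod.case
      by (intro rec_in_rel[OF r[folded r_def]] rec_intros) auto
  qed
  ultimately obtain h \<delta> where \<delta>: "\<delta> < omega1_CK X" and below: "\<And>u. u \<in> T \<Longrightarrow> h u < \<delta>"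
    and mono: "\<And>u v. u \<in> T \<Longrightarrow> v \<in> T \<Longrightarrow> \<kappa> u < \<kappa> v \<Longrightarrow> h u < h v"
    by (rule computable_collapse) blast
  define f where "f \<gamma> = h (Suc (inv_into S g \<gamma>))" for \<gamma>
  have inv: "inv_into S g \<gamma> \<in> S" "g (inv_into S g \<gamma>) = \<gamma>" if "\<gamma> < \<alpha>" for \<gamma>
    using bij_betw_imp_surj_on[OF g] that by (auto simp: inv_into_into f_inv_into_f)
  have "\<gamma> \<le> f \<gamma>" if "\<gamma> < \<alpha>" for \<gamma>
    using that inv unfolding f_def
    by (intro le_strict_mono_cord[of \<alpha> "\<lambda>\<gamma>. h (Suc (inv_into S g \<gamma>))"] mono) (auto simp: T \<kappa>_def)
  moreover have "f \<gamma> < h 0" if "\<gamma> < \<alpha>" for \<gamma>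
    using that inv unfolding f_def by (intro mono) (auto simp: T \<kappa>_def)
  \<comment> \<open>If h 0 were below \<alpha>, then h 0 \<le> f (h 0) < h 0.\<close>
  ultimately have "\<alpha> \<le> h 0"
    by (meson leI order.strict_trans1 order.irrefl)
  also have "h 0 < \<delta>"
    by (rule below) (simp add: T)
  finally show ?thesis
    using \<delta> by (simp add: osuc_le_iff order.strict_trans1)
qed

text \<open>
  The distance of \<open>z\<close> from the largest square below it; it takes each value infinitely often.
\<close>

definition excess :: "nat \<Rightarrow> nat" where
  "excess z = z - (LEAST y. z < Suc y * Suc y) * (LEAST y. z < Suc y * Suc y)"

lemma excess_square_plus:
  assumes "x \<le> s"
  shows "excess (s * s + x) = x"
proof -
  have "(LEAST y. s * s + x < Suc y * Suc y) = s"
  proof (rule Least_equality)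
    show "s * s + x < Suc s * Suc s" using assms by simp
    fix y assume y: "s * s + x < Suc y * Suc y"
    show "s \<le> y"
    proof (rule ccontr)
      assume "\<not> s \<le> y"
      then have "Suc y * Suc y \<le> s * s" by (intro mult_mono) auto
      with y show False by simp
    qed
  qed
  then show ?thesis by (simp add: excess_def)
qed

lemma rec_in_excess:
  assumes "rec_in X n f"
  shows "rec_in X n (\<lambda>xs. excess (f xs))"
proof (rule rec_in_comp1[OF _ assms, of excess])
  \<comment> \<open>The truncated difference vanishes exactly when the argument is below the square
    of \<open>Suc y\<close>. The argument itself is such a \<open>y\<close>, so the minimization is
    regular.\<close>
  have "rec_in X 1 (\<lambda>xs. LEAST y. (\<lambda>ys. Suc (ys ! 1) - Suc (ys ! 0) * Suc (ys ! 0)) (y # xs) = 0)"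
    unfolding One_nat_def
  proof (intro rec_in.mini rec_intros allI impI)
    fix xs :: "nat list"
    have "Suc (xs ! 0) \<le> Suc (xs ! 0) * Suc (xs ! 0)" by simp
    then show "\<exists>y. Suc ((y # xs) ! Suc 0) - Suc ((y # xs) ! 0) * Suc ((y # xs) ! 0) = 0"
      by (intro exI[of _ "xs ! 0"]) simp
  qed auto
  then have *: "rec_in X 1 (\<lambda>xs. LEAST y. xs ! 0 < Suc y * Suc y)"
    by (elim rec_in.cong) (auto simp: less_Suc_eq_le)
  show "rec_in X 1 (\<lambda>xs. excess (xs ! 0))"
    unfolding excess_def by (intro rec_intros *) auto
qed

text \<open>Read \<open>f \<gamma> n\<close> as \<omega> \<cdot> \<gamma> + n. The back-and-forth
  games below use only these order relations; the common bound \<delta> gives the uniformity over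
  tuples.\<close>

lemma ex_lex_embedding:
  assumes "\<alpha> < omega1_CK X"
  obtains \<delta> f where "\<delta> < omega1_CK X"
    and "\<And>\<gamma> n. \<gamma> < \<alpha> \<Longrightarrow> f \<gamma> n < \<delta>"
    and "\<And>\<gamma> n. \<gamma> < \<alpha> \<Longrightarrow> f \<gamma> n < f \<gamma> (Suc n)"
    and "\<And>\<beta> \<gamma> n. \<beta> < \<gamma> \<Longrightarrow> \<gamma> < \<alpha> \<Longrightarrow> f \<beta> n < f \<gamma> (0::nat)"
proof -
  obtain S g where g: "bij_betw g S {..<\<alpha>}"
    and r: "computes_rel X {(u, v). u \<in> S \<and> v \<in> S \<and> g u \<le> g v}"
    using assms unfolding computable_ordinal_iff_less[symmetric] computable_ordinal_iff by blast
  define r where "r = {(u, v). u \<in> S \<and> v \<in> S \<and> g u \<le> g v}"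
  \<comment> \<open>Every fibre of \<open>excess\<close> is infinite, so this orders the fibres over \<open>S\<close> in type \<open>\<omega> \<cdot> \<alpha>\<close>.\<close>
  define \<kappa> where "\<kappa> z = (g (excess z), z)" for z
  define T where "T = {z. excess z \<in> S}"
  have "inj_on \<kappa> T"
    by (auto simp: inj_on_def \<kappa>_def)
  moreover have "computes_rel X {(u, v). u \<in> T \<and> v \<in> T \<and> \<kappa> u \<le> \<kappa> v}"
  proof -
    have eq: "(u \<in> T \<and> v \<in> T \<and> \<kappa> u \<le> \<kappa> v) \<longleftrightarrow>
        (excess u, excess v) \<in> r \<and> ((excess v, excess u) \<notin> r \<or> u \<le> v)" for u v
      by (auto simp: T_def \<kappa>_def r_def less_eq_prod_def)
    show ?thesis
      unfolding eq computes_rel_def mem_Collect_eq prod.case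
      by (intro rec_in_rel[OF r[folded r_def]] rec_in_excess rec_intros) auto
  qed
  ultimately obtain h \<delta> where \<delta>: "\<delta> < omega1_CK X" and below: "\<And>u. u \<in> T \<Longrightarrow> h u < \<delta>"
    and mono: "\<And>u v. u \<in> T \<Longrightarrow> v \<in> T \<Longrightarrow> \<kappa> u < \<kappa> v \<Longrightarrow> h u < h v"
    by (rule computable_collapse) blast
  \<comment> \<open>Members of the fibre over the code of \<gamma>. The square root is the code plus
    n, hence at least the code, as \<open>excess_square_plus\<close> requires.\<close>
  define c where "c \<gamma> n = (inv_into S g \<gamma> + n) * (inv_into S g \<gamma> + n) + inv_into S g \<gamma>" for \<gamma> n
  have excess: "excess (c \<gamma> n) = inv_into S g \<gamma>" for \<gamma> n
    unfolding c_def by (rule excess_square_plus) simp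
  have inv: "inv_into S g \<gamma> \<in> S" "g (inv_into S g \<gamma>) = \<gamma>" if "\<gamma> < \<alpha>" for \<gamma>
    using bij_betw_imp_surj_on[OF g] that by (auto simp: inv_into_into f_inv_into_f)
  have T: "c \<gamma> n \<in> T" if "\<gamma> < \<alpha>" for \<gamma> n
    using inv(1)[OF that] by (simp add: T_def excess)
  have \<kappa>: "\<kappa> (c \<gamma> n) = (\<gamma>, c \<gamma> n)" if "\<gamma> < \<alpha>" for \<gamma> n
    using inv(2)[OF that] by (simp add: \<kappa>_def excess)
  show thesis
  proof (rule that[of \<delta> "\<lambda>\<gamma> n. h (c \<gamma> n)", OF \<delta>])
    show "h (c \<gamma> n) < \<delta>" if "\<gamma> < \<alpha>" for \<gamma> n
      using below T[OF that] by blast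
    have "c \<gamma> n < c \<gamma> (Suc n)" for \<gamma> n
      by (simp add: c_def)
    then show "h (c \<gamma> n) < h (c \<gamma> (Suc n))" if "\<gamma> < \<alpha>" for \<gamma> n
      using that by (intro mono T) (simp_all add: \<kappa>)
    show "h (c \<beta> n) < h (c \<gamma> 0)" if "\<beta> < \<gamma>" "\<gamma> < \<alpha>" for \<beta> \<gamma> n
      using that by (intro mono T) (auto simp: \<kappa>)
  qed
qed

subsection \<open>Satisfaction and isomorphism\<close>

lemma finite_fv_tm: "finite (fv_tm t)"
  by (induction t) auto

lemma finite_fv_atm: "finite (fv_atm p)"
  by (cases p) (auto simp: finite_fv_tm)

lemma tm_val_cong: "(\<And>i. i \<in> fv_tm t \<Longrightarrow> s i = s' i) \<Longrightarrow> tm_val A s t = tm_val A s' t"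
proof (induction t)
  case (Fn f ts)
  then have "map (tm_val A s) ts = map (tm_val A s') ts"
    by (intro map_cong refl Fn.IH) auto
  then show ?case by (simp del: map_eq_conv)
qed simp

lemma sat_atm_cong:
  assumes "\<And>i. i \<in> fv_atm p \<Longrightarrow> s i = s' i"
  shows "sat_atm A s p \<longleftrightarrow> sat_atm A s' p"
proof (cases p)
  case (Eq t u)
  with assms show ?thesis
    using tm_val_cong[of t s s' A] tm_val_cong[of u s s' A] by auto
next
  case (Rl R ts)
  then have "map (tm_val A s) ts = map (tm_val A s') ts"
    using assms by (intro map_cong refl tm_val_cong) auto
  with Rl show ?thesis by (simp del: map_eq_conv)
qed

lemma sat_cong: "(\<And>i. i \<in> fv \<phi> \<Longrightarrow> s i = s' i) \<Longrightarrow> sat A \<phi> s \<longleftrightarrow> sat A \<phi> s'"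
proof (induction \<phi> arbitrary: s s')
  case (Atom p)
  show ?case
    unfolding sat.simps by (rule sat_atm_cong) (rule Atom, simp)
next
  case (Neg \<phi>)
  have "sat A \<phi> s \<longleftrightarrow> sat A \<phi> s'"
    by (rule Neg.IH, rule Neg.prems) simp
  then show ?case by simp
next
  case (And \<phi> \<psi>)
  have "sat A \<phi> s \<longleftrightarrow> sat A \<phi> s'" "sat A \<psi> s \<longleftrightarrow> sat A \<psi> s'"
    by (rule And.IH; rule And.prems; simp)+
  then show ?case by simp
next
  case (BigAnd F)
  have "sat A (F i) s \<longleftrightarrow> sat A (F i) s'" for i
    by (rule BigAnd.IH[OF rangeI], rule BigAnd.prems) auto
  then show ?case by simp
next
  case (Ex x \<phi>)
  have "sat A \<phi> (s(x := c)) \<longleftrightarrow> sat A \<phi> (s'(x := c))" for c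
    by (rule Ex.IH) (use Ex.prems in simp)
  then show ?case by simp
qed

lemma tm_val_in_univ:
  assumes "is_structure L A" "wf_tm L t" "\<And>i. s i \<in> univ A"
  shows "tm_val A s t \<in> univ A"
  using assms(2)
proof (induction t)
  case (Var i)
  show ?case using assms(3) by simp
next
  case (Fn f ts)
  then have "map (tm_val A s) ts \<in> lists (univ A)"
    by (auto simp: list_all_iff)
  with Fn.prems assms(1) show ?case
    by (auto simp: is_structure_def)
qed

lemma tm_val_isomorphism:
  assumes "is_structure L A" "isomorphism L A B h" "wf_tm L t" "\<And>i. s i \<in> univ A"
  shows "tm_val B (\<lambda>i. h (s i)) t = h (tm_val A s t)"
  using assms(3)
proof (induction t)
  case (Fn f ts)
  have "map (tm_val B (\<lambda>i. h (s i))) ts = map h (map (tm_val A s) ts)"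
    using Fn by (auto simp: list_all_iff)
  moreover have "map (tm_val A s) ts \<in> lists (univ A)"
    using Fn.prems tm_val_in_univ[OF assms(1) _ assms(4)] by (auto simp: list_all_iff)
  ultimately show ?case
    using Fn.prems assms(2) by (simp add: isomorphism_def del: map_eq_conv map_map)
qed simp

lemma sat_atm_isomorphism:
  assumes "is_structure L A" "isomorphism L A B h" "wf_atm L p" "\<And>i. s i \<in> univ A"
  shows "sat_atm B (\<lambda>i. h (s i)) p \<longleftrightarrow> sat_atm A s p"
proof (cases p)
  case (Eq t u)
  with assms show ?thesis
    using tm_val_in_univ[OF assms(1) _ assms(4)] tm_val_isomorphism[OF assms(1,2) _ assms(4)]
    by (auto simp: isomorphism_def bij_betw_def inj_on_eq_iff)
next
  case (Rl R ts)
  have "map (tm_val B (\<lambda>i. h (s i))) ts = map h (map (tm_val A s) ts)"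
    using Rl assms(3) tm_val_isomorphism[OF assms(1,2) _ assms(4)] by auto
  moreover have "map (tm_val A s) ts \<in> lists (univ A)"
    using Rl assms(3) tm_val_in_univ[OF assms(1) _ assms(4)] by auto
  ultimately show ?thesis
    using Rl assms(2,3) by (simp add: isomorphism_def del: map_eq_conv map_map)
qed

lemma sat_isomorphism:
  assumes "is_structure L A" "isomorphism L A B h"
  shows "wf_fm L \<phi> \<Longrightarrow> (\<And>i. s i \<in> univ A) \<Longrightarrow> sat B \<phi> (\<lambda>i. h (s i)) \<longleftrightarrow> sat A \<phi> s"
proof (induction \<phi> arbitrary: s)
  case (Ex x \<phi>)
  have univ: "univ B = h ` univ A"
    using assms(2) by (simp add: isomorphism_def bij_betw_def)
  have "sat B \<phi> ((\<lambda>i. h (s i))(x := h c)) \<longleftrightarrow> sat A \<phi> (s(x := c))" if "c \<in> univ A" for c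
  proof -
    have "sat B \<phi> (\<lambda>i. h ((s(x := c)) i)) \<longleftrightarrow> sat A \<phi> (s(x := c))"
      by (rule Ex.IH) (use Ex.prems that in auto)
    moreover have "(\<lambda>i. h ((s(x := c)) i)) = (\<lambda>i. h (s i))(x := h c)"
      by auto
    ultimately show ?thesis by (simp only:)
  qed
  then show ?case
    by (simp add: univ)
qed (auto simp: sat_atm_isomorphism[OF assms])

lemma automorphic_imp_same_fms:
  assumes "is_structure L A" "automorphic L A as bs" "as \<in> lists (univ A)"
  shows "same_fms L A as bs"
proof -
  obtain h where h: "isomorphism L A A h" and bs: "bs = map h as"
    using assms(2) by (auto simp: automorphic_def)
  obtain e where e: "e \<in> univ A"
    using assms(1) by (auto simp: is_structure_def)
  \<comment> \<open>Beyond the tuple, \<open>(!) as\<close> is unconstrained. Padding with an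
    element of the universe gives an assignment to which isomorphism invariance applies and which
    agrees on the free variables.\<close>
  define s where "s i = (if i < length as then as ! i else e)" for i
  have s: "s i \<in> univ A" for i
    using assms(3) e by (auto simp: s_def)
  have "sat A \<phi> ((!) as) \<longleftrightarrow> sat A \<phi> ((!) bs)" if "wf_fm L \<phi>" "fv \<phi> \<subseteq> {..<length as}" for \<phi>
  proof -
    have "sat A \<phi> ((!) as) \<longleftrightarrow> sat A \<phi> s"
      using that(2) by (intro sat_cong) (auto simp: s_def)
    also have "\<dots> \<longleftrightarrow> sat A \<phi> (\<lambda>i. h (s i))"
      using sat_isomorphism[OF assms(1) h that(1) s] by simp
    also have "\<dots> \<longleftrightarrow> sat A \<phi> ((!) bs)"
      using that(2) by (intro sat_cong) (auto simp: s_def bs)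
    finally show ?thesis .
  qed
  then show ?thesis
    by (simp add: same_fms_def bs)
qed

lemma same_open_fms_iff: "same_open_fms L A as bs \<longleftrightarrow> same_atomic_type L A as bs"
proof
  assume *: "same_open_fms L A as bs"
  have "sat_atm A ((!) as) p \<longleftrightarrow> sat_atm A ((!) bs) p" if "wf_atm L p" "fv_atm p \<subseteq> {..<length as}" for p
    using *[unfolded same_open_fms_def, THEN conjunct2, rule_format, of "Atom p"] that by simp
  with * show "same_atomic_type L A as bs"
    by (simp add: same_open_fms_def same_atomic_type_def)
next
  assume *: "same_atomic_type L A as bs"
  have "sat A \<phi> ((!) as) \<longleftrightarrow> sat A \<phi> ((!) bs)"
    if "wf_fm L \<phi>" "open_fm \<phi>" "fv \<phi> \<subseteq> {..<length as}" for \<phi>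
    using that by (induction \<phi>) (use * in \<open>auto simp: same_atomic_type_def\<close>)
  with * show "same_open_fms L A as bs"
    by (simp add: same_open_fms_def same_atomic_type_def)
qed

lemma same_fms_imp_same_atomic_type: "same_fms L A as bs \<Longrightarrow> same_atomic_type L A as bs"
  unfolding same_open_fms_iff[symmetric] by (simp add: same_fms_def same_open_fms_def)

lemma same_atomic_type_butlast:
  assumes "same_atomic_type L A (as @ [c]) (bs @ [d])"
  shows "same_atomic_type L A as bs"
proof -
  have len: "length as = length bs"
    using assms by (simp add: same_atomic_type_def)
  have "sat_atm A ((!) as) p \<longleftrightarrow> sat_atm A ((!) bs) p" if "wf_atm L p" "fv_atm p \<subseteq> {..<length as}" for p
  proof -
    have "sat_atm A ((!) as) p \<longleftrightarrow> sat_atm A ((!) (as @ [c])) p"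
      using that(2) by (intro sat_atm_cong) (auto simp: nth_append)
    also have "\<dots> \<longleftrightarrow> sat_atm A ((!) (bs @ [d])) p"
      using assms that(1) subset_trans[OF that(2), of "{..<Suc (length as)}"]
      by (simp add: same_atomic_type_def)
    also have "\<dots> \<longleftrightarrow> sat_atm A ((!) bs) p"
      using that(2) len by (intro sat_atm_cong) (auto simp: nth_append)
    finally show ?thesis .
  qed
  with len show ?thesis by (simp add: same_atomic_type_def)
qed

subsection \<open>Scott's isomorphism theorem\<close>

text \<open>Equality atoms make a i \<mapsto> b i well defined and injective. They also handle
  functions: each value is some \<open>a j\<close>, so \<open>Var j\<close> names it.\<close>

lemma isomorphism_of_enumerations:
  assumes "is_structure L A" "range a = univ A" "range b = univ A"
    and sat: "\<And>p. wf_atm L p \<Longrightarrow> sat_atm A a p \<longleftrightarrow> sat_atm A b p"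
  obtains h where "isomorphism L A A h" and "\<And>i. h (a i) = b i"
proof -
  have eq: "a i = a j \<longleftrightarrow> b i = b j" for i j
    using sat[of "Eq (Var i) (Var j)"] by simp
  define h where "h x = b (LEAST i. a i = x)" for x
  have h: "h (a i) = b i" for i
    unfolding h_def using eq LeastI[of "\<lambda>j. a j = a i" i] by simp
  have lists: "\<exists>is. as = map a is" if "as \<in> lists (univ A)" for as
    using that unfolding assms(2)[symmetric] by (metis ex_map_conv in_listsD rangeE)
  have "bij_betw h (univ A) (univ A)"
    unfolding bij_betw_def
  proof
    show "inj_on h (univ A)"
      unfolding assms(2)[symmetric] by (auto simp: inj_on_def h eq)
    show "h ` univ A = univ A"
      unfolding assms(2)[symmetric] image_image h using assms(2,3) by simp
  qed
  moreover have "rel A R as \<longleftrightarrow> rel A R (map h as)"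
    if "R \<in> rels L" "as \<in> lists (univ A)" "length as = rel_arity L R" for R as
  proof -
    obtain "is" where "as = map a is" using lists[OF \<open>as \<in> _\<close>] by blast
    then show ?thesis
      using sat[of "Rl R (map Var is)"] that by (simp add: comp_def h)
  qed
  moreover have "h (func A f as) = func A f (map h as)"
    if "f \<in> funs L" "as \<in> lists (univ A)" "length as = fun_arity L f" for f as
  proof -
    obtain "is" where "is": "as = map a is" using lists[OF \<open>as \<in> _\<close>] by blast
    have "func A f as \<in> univ A"
      using assms(1) that by (simp add: is_structure_def)
    then obtain j where "func A f as = a j"
      unfolding assms(2)[symmetric] by blast
    then show ?thesis
      using sat[of "Eq (Fn f (map Var is)) (Var j)"] that
      by (simp add: "is" comp_def h list_all_iff)
  qed
  ultimately show thesis
    using h by (intro that[of h]) (auto simp: isomorphism_def)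
qed

text \<open>
  Iterating the extension property against an enumeration of the universe gives two enumerations
  of it, one starting with \<open>as\<close> and one with \<open>bs\<close>, which satisfy the same atomic formulas.
\<close>

lemma back_and_forth:
  assumes str: "is_structure L A" and ctbl: "countable (univ A)"
    and atomic: "\<And>as bs. E as bs \<Longrightarrow> same_atomic_type L A as bs"
    and forward: "\<And>as bs c. E as bs \<Longrightarrow> c \<in> univ A \<Longrightarrow> \<exists>d\<in>univ A. E (as @ [c]) (bs @ [d])"
    and backward: "\<And>as bs d. E as bs \<Longrightarrow> d \<in> univ A \<Longrightarrow> \<exists>c\<in>univ A. E (as @ [c]) (bs @ [d])"
    and E: "E as bs" "as \<in> lists (univ A)" "bs \<in> lists (univ A)"
  shows "automorphic L A as bs"
proof -
  have ne: "univ A \<noteq> {}" using str by (simp add: is_structure_def)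
  define e where "e = from_nat_into (univ A)"
  have e: "range e = univ A"
    unfolding e_def by (rule range_from_nat_into[OF ne ctbl])
  \<comment> \<open>The length condition ensures that entry i is present from stage i + 1 on; the
    clause for stage 0 makes the sequence start at the given tuples.\<close>
  define Q where "Q n P \<longleftrightarrow> E (fst P) (snd P) \<and> fst P \<in> lists (univ A) \<and> snd P \<in> lists (univ A) \<and>
    n \<le> length (fst P) \<and> (n = 0 \<longrightarrow> P = (as, bs))" for n :: nat and P
  define ext where "ext n P P' \<longleftrightarrow> (\<exists>cs ds. fst P' = fst P @ cs \<and> snd P' = snd P @ ds \<and>
    length cs = length ds \<and> e n \<in> set cs \<and> e n \<in> set ds)" for n P P'
  have "\<exists>P'. Q (Suc n) P' \<and> ext n P P'" if Q: "Q n P" for n P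
  proof -
    obtain d where d: "d \<in> univ A" "E (fst P @ [e n]) (snd P @ [d])"
      using forward[of "fst P" "snd P" "e n"] Q e by (auto simp: Q_def)
    obtain c where c: "c \<in> univ A" "E (fst P @ [e n, c]) (snd P @ [d, e n])"
      using backward[OF d(2), of "e n"] e by auto
    have "e n \<in> univ A" using e by blast
    with c d Q show ?thesis
      by (intro exI[of _ "(fst P @ [e n, c], snd P @ [d, e n])"]) (auto simp: Q_def ext_def)
  qed
  moreover have "Q 0 (as, bs)"
    using E by (simp add: Q_def)
  ultimately obtain P where Q: "\<And>n. Q n (P n)" and ext: "\<And>n. ext n (P n) (P (Suc n))"
    using dependent_nat_choice[of Q ext] by blast
  have len: "length (fst (P n)) = length (snd (P n))" for n
    using Q[of n] atomic by (auto simp: Q_def same_atomic_type_def)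
  define a b where "a i = fst (P (Suc i)) ! i" and "b i = snd (P (Suc i)) ! i" for i
  have prefix: "\<exists>cs ds. fst (P n) = fst (P m) @ cs \<and> snd (P n) = snd (P m) @ ds" if "m \<le> n" for m n
    using that
  proof (induction rule: dec_induct)
    case (step k)
    then show ?case using ext[of k] by (auto simp: ext_def)
  qed simp
  have nth: "fst (P n) ! i = a i \<and> snd (P n) ! i = b i" if "i < length (fst (P n))" for n i
  proof -
    have i: "i < length (fst (P (Suc i)))"
      using Q[of "Suc i"] by (simp add: Q_def)
    show ?thesis
      using prefix[of n "Suc i"] prefix[of "Suc i" n] that i len[of n] len[of "Suc i"]
      unfolding a_def b_def by (cases "n \<le> Suc i") (auto simp: nth_append)
  qed
  have in_univ: "a i \<in> univ A" "b i \<in> univ A" for i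
    using Q[of "Suc i"] len[of "Suc i"] unfolding a_def b_def Q_def by (auto simp: in_lists_conv_set)
  have "e n \<in> range a" "e n \<in> range b" for n
  proof -
    have "e n \<in> set (fst (P (Suc n)))" "e n \<in> set (snd (P (Suc n)))"
      using ext[of n] by (auto simp: ext_def)
    then show "e n \<in> range a" "e n \<in> range b"
      using nth len by (metis in_set_conv_nth rangeI)+
  qed
  then have "range e \<subseteq> range a" "range e \<subseteq> range b"
    by auto
  then have "range a = univ A" "range b = univ A"
    using in_univ unfolding e by auto
  moreover have "sat_atm A a p \<longleftrightarrow> sat_atm A b p" if "wf_atm L p" for p
  proof -
    \<comment> \<open>An atom has finitely many variables, so a single stage decides it.\<close>
    obtain n where n: "fv_atm p \<subseteq> {..<n}"
      using finite_fv_atm[of p] finite_nat_iff_bounded by blast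
    have *: "i < length (fst (P n))" if "i \<in> fv_atm p" for i
      using n that Q[of n] by (auto simp: Q_def)
    have "sat_atm A a p \<longleftrightarrow> sat_atm A ((!) (fst (P n))) p"
      using nth * by (intro sat_atm_cong) auto
    also have "\<dots> \<longleftrightarrow> sat_atm A ((!) (snd (P n))) p"
      using atomic[of "fst (P n)" "snd (P n)"] Q[of n] that *
      by (auto simp: same_atomic_type_def Q_def)
    also have "\<dots> \<longleftrightarrow> sat_atm A b p"
      using nth * by (intro sat_atm_cong) auto
    finally show ?thesis .
  qed
  ultimately obtain h where h: "isomorphism L A A h" "\<And>i. h (a i) = b i"
    using isomorphism_of_enumerations[OF str] by blast
  have "map h as = bs"
  proof (rule nth_equalityI)
    have P: "P 0 = (as, bs)" using Q[of 0] by (simp add: Q_def)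
    show "length (map h as) = length bs" using len[of 0] P by simp
    show "map h as ! i = bs ! i" if "i < length (map h as)" for i
      using nth[of i 0] that h(2)[of i] P by simp
  qed
  with h(1) show ?thesis by (auto simp: automorphic_def)
qed

lemma same_fms_sym: "same_fms L A as bs \<Longrightarrow> same_fms L A bs as"
  by (auto simp: same_fms_def)

text \<open>If each \<open>d\<close> were separated from \<open>c\<close> by a formula, the
  countable conjunction of these formulas, quantified over the new entry, would hold of
  \<open>as\<close> and fail of \<open>bs\<close>.\<close>

lemma same_fms_forth:
  assumes str: "is_structure L A" and ctbl: "countable (univ A)"
    and same: "same_fms L A as bs" and c: "c \<in> univ A"
  shows "\<exists>d\<in>univ A. same_fms L A (as @ [c]) (bs @ [d])"
proof (rule ccontr)
  assume neg: "\<not> ?thesis"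
  have len: "length as = length bs" using same by (simp add: same_fms_def)
  \<comment> \<open>The appended entry has index \<open>length as\<close>, so this is the variable
    quantified in \<open>\<psi>\<close>.\<close>
  have upd: "sat A \<phi> (((!) xs)(length as := x)) \<longleftrightarrow> sat A \<phi> ((!) (xs @ [x]))"
    if "fv \<phi> \<subseteq> {..<Suc (length as)}" "length xs = length as" for xs x \<phi>
    using that by (intro sat_cong) (auto simp: nth_append less_Suc_eq)
  have "\<exists>\<phi>. wf_fm L \<phi> \<and> fv \<phi> \<subseteq> {..<Suc (length as)} \<and>
    sat A \<phi> ((!) (as @ [c])) \<and> \<not> sat A \<phi> ((!) (bs @ [d]))" if d: "d \<in> univ A" for d
  proof -
    obtain \<phi> where "wf_fm L \<phi>" "fv \<phi> \<subseteq> {..<Suc (length as)}"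
      "sat A \<phi> ((!) (as @ [c])) \<noteq> sat A \<phi> ((!) (bs @ [d]))"
      using neg d len by (auto simp: same_fms_def)
    then show ?thesis
      by (intro exI[of _ "if sat A \<phi> ((!) (as @ [c])) then \<phi> else Neg \<phi>"]) simp
  qed
  then obtain \<Phi> where \<Phi>: "\<And>d. d \<in> univ A \<Longrightarrow> wf_fm L (\<Phi> d) \<and> fv (\<Phi> d) \<subseteq> {..<Suc (length as)} \<and>
    sat A (\<Phi> d) ((!) (as @ [c])) \<and> \<not> sat A (\<Phi> d) ((!) (bs @ [d]))"
    by metis
  define e where "e = from_nat_into (univ A)"
  have "univ A \<noteq> {}" using c by blast
  then have e: "range e = univ A"
    unfolding e_def using ctbl by (rule range_from_nat_into)
  then have e': "e i \<in> univ A" for i by blast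
  define \<psi> where "\<psi> = Ex (length as) (BigAnd (\<lambda>i. \<Phi> (e i)))"
  have fv: "fv (\<Phi> (e i)) \<subseteq> {..<Suc (length as)}" for i
    using \<Phi>[OF e'] by blast
  then have "fv \<psi> \<subseteq> {..<length as}"
    unfolding \<psi>_def fv.simps by (fastforce simp: less_Suc_eq)
  moreover have "wf_fm L \<psi>"
    using \<Phi>[OF e'] by (simp add: \<psi>_def)
  ultimately have "sat A \<psi> ((!) as) \<longleftrightarrow> sat A \<psi> ((!) bs)"
    using same by (simp add: same_fms_def)
  moreover have "sat A \<psi> ((!) as)"
    using \<Phi>[OF e'] c upd[OF fv, of as] by (auto simp: \<psi>_def)
  moreover have "\<not> sat A \<psi> ((!) bs)"
  proof
    assume "sat A \<psi> ((!) bs)"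
    then obtain d where "d \<in> univ A" "\<And>i. sat A (\<Phi> (e i)) ((!) (bs @ [d]))"
      using upd[OF fv, of bs] len by (auto simp: \<psi>_def)
    then show False
      using \<Phi> e by (metis rangeE)
  qed
  ultimately show False by simp
qed

text \<open>\<open>same_fms\<close> is itself a back-and-forth relation; its backward half is the
  forward half with the tuples exchanged.\<close>

lemma same_fms_iff_automorphic:
  assumes "is_structure L A" "countable (univ A)" "as \<in> lists (univ A)" "bs \<in> lists (univ A)"
  shows "same_fms L A as bs \<longleftrightarrow> automorphic L A as bs"
proof
  assume same: "same_fms L A as bs"
  show "automorphic L A as bs"
  proof (rule back_and_forth[where E = "same_fms L A", OF assms(1,2) _ _ _ same assms(3,4)])
    show "\<exists>c\<in>univ A. same_fms L A (as @ [c]) (bs @ [d])"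
      if "same_fms L A as bs" "d \<in> univ A" for as bs d
      using same_fms_forth[OF assms(1,2) same_fms_sym[OF that(1)] that(2)] same_fms_sym by blast
  qed (rule same_fms_imp_same_atomic_type same_fms_forth[OF assms(1,2)]; assumption)+
next
  assume "automorphic L A as bs"
  then show "same_fms L A as bs"
    using automorphic_imp_same_fms assms by blast
qed

subsection \<open>Back-and-forth relations\<close>

lemma sim_in_lists: "sim L A \<alpha> as bs \<Longrightarrow> as \<in> lists (univ A) \<and> bs \<in> lists (univ A) \<and> length as = length bs"
  by (simp add: sim.simps)

lemma simAK_in_lists: "simAK L A \<alpha> as bs \<Longrightarrow> as \<in> lists (univ A) \<and> bs \<in> lists (univ A) \<and> length as = length bs"
  by (simp add: simAK.simps)

lemma sim_0:
  "sim L A 0 as bs \<longleftrightarrow> as \<in> lists (univ A) \<and> bs \<in> lists (univ A) \<and> same_atomic_type L A as bs"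
  by (subst sim.simps) (auto simp: same_atomic_type_def)

lemma sim_osuc:
  "sim L A (osuc \<alpha>) as bs \<longleftrightarrow>
    as \<in> lists (univ A) \<and> bs \<in> lists (univ A) \<and> length as = length bs \<and>
    (\<forall>c\<in>univ A. \<exists>d\<in>univ A. sim L A \<alpha> (as @ [c]) (bs @ [d])) \<and>
    (\<forall>d\<in>univ A. \<exists>c\<in>univ A. sim L A \<alpha> (as @ [c]) (bs @ [d]))"
  by (subst sim.simps) auto

lemma sim_limit:
  assumes "\<alpha> \<noteq> 0" "\<And>\<beta>. \<alpha> \<noteq> osuc \<beta>"
  shows "sim L A \<alpha> as bs \<longleftrightarrow> (\<forall>\<beta><\<alpha>. sim L A \<beta> as bs)"
proof -
  have "0 < \<alpha>" using assms(1) zero_le_cord[of \<alpha>] by (simp add: le_less)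
  then show ?thesis
    using assms sim_in_lists[of L A 0 as bs] by (subst sim.simps) auto
qed

lemma simAK_0:
  "simAK L A 0 as bs \<longleftrightarrow> as \<in> lists (univ A) \<and> bs \<in> lists (univ A) \<and> same_atomic_type L A as bs"
  by (subst simAK.simps) (auto simp: same_open_fms_iff same_atomic_type_def)

lemma simAK_nonzero:
  assumes "\<alpha> \<noteq> 0"
  shows "simAK L A \<alpha> as bs \<longleftrightarrow>
    as \<in> lists (univ A) \<and> bs \<in> lists (univ A) \<and> length as = length bs \<and>
    (\<forall>\<gamma><\<alpha>.
       (\<forall>cs\<in>lists (univ A). \<exists>ds\<in>lists (univ A).
          length cs = length ds \<and> simAK L A \<gamma> (as @ cs) (bs @ ds)) \<and>
       (\<forall>ds\<in>lists (univ A). \<exists>cs\<in>lists (univ A).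
          length cs = length ds \<and> simAK L A \<gamma> (as @ cs) (bs @ ds)))"
  using assms by (subst simAK.simps) auto

lemma cord_cases:
  obtains "\<alpha> = 0" | \<beta> where "\<alpha> = osuc \<beta>" | "\<alpha> \<noteq> 0" "\<And>\<beta>. \<alpha> \<noteq> osuc \<beta>"
  by blast

text \<open>A successor level speaks only of extensions, so the outer induction covers all tuples;
  the inner one reassembles \<open>sim\<close> at \<beta> from extensions at lower levels.\<close>

lemma sim_mono:
  assumes ne: "univ A \<noteq> {}"
  shows "sim L A \<alpha> as bs \<Longrightarrow> \<beta> \<le> \<alpha> \<Longrightarrow> sim L A \<beta> as bs"
proof (induction \<alpha> arbitrary: \<beta> as bs rule: less_induct)
  case (less \<alpha>)
  note IH = less.IH and sim = less.prems(1)
  from less.prems(2) show ?case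
  proof (induction \<beta> rule: less_induct)
    case (less \<beta>)
    show ?case
    proof (cases "\<beta> = \<alpha>")
      case True
      with sim show ?thesis by simp
    next
      case False
      with less.prems have "\<beta> < \<alpha>" by simp
      show ?thesis
      proof (cases \<alpha> rule: cord_cases)
        case 1
        with \<open>\<beta> < \<alpha>\<close> show ?thesis by (simp flip: not_le)
      next
        case 3
        with \<open>\<beta> < \<alpha>\<close> sim show ?thesis by (simp add: sim_limit)
      next
        case (2 \<gamma>)
        have \<beta>: "\<beta> \<le> \<gamma>" using \<open>\<beta> < \<alpha>\<close> 2 by (simp add: less_osuc_iff)
        have ext: "\<forall>c\<in>univ A. \<exists>d\<in>univ A. sim L A \<delta> (as @ [c]) (bs @ [d])"
          "\<forall>d\<in>univ A. \<exists>c\<in>univ A. sim L A \<delta> (as @ [c]) (bs @ [d])" if "\<delta> \<le> \<gamma>" for \<delta>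
          using IH[of \<gamma> _ _ \<delta>] less_osuc[of \<gamma>] that sim unfolding 2 sim_osuc by blast+
        show ?thesis
        proof (cases \<beta> rule: cord_cases)
          case 1
          \<comment> \<open>Level 0 is read off some extension, which exists because the universe is
            nonempty.\<close>
          obtain c d where "sim L A 0 (as @ [c]) (bs @ [d])"
            using ext[of 0] ne by (meson ex_in_conv zero_le_cord)
          then show ?thesis
            using same_atomic_type_butlast unfolding 1 by (fastforce simp: sim_0)
        next
          case (2 \<delta>)
          with \<beta> less_osuc[of \<delta>] have "\<delta> \<le> \<gamma>" by simp
          with ext sim_in_lists[OF sim] show ?thesis by (simp add: 2 sim_osuc)
        next
          case 3
          with less show ?thesis by (simp add: sim_limit)
        qed
      qed
    qed
  qed
qed

lemma simAK_mono:
  assumes "simAK L A \<alpha> as bs" "\<beta> \<le> \<alpha>"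
  shows "simAK L A \<beta> as bs"
proof (cases "\<beta> = 0")
  case True
  show ?thesis
  proof (cases "\<alpha> = 0")
    case False
    then have "0 < \<alpha>" using zero_le_cord[of \<alpha>] by (simp add: le_less)
    \<comment> \<open>The empty tuple is a legal move, so level 0 holds of the tuples
      themselves.\<close>
    then have "\<exists>ds\<in>lists (univ A). 0 = length ds \<and> simAK L A 0 as (bs @ ds)"
      using assms(1)[unfolded simAK_nonzero[OF False], THEN conjunct2, THEN conjunct2, THEN conjunct2,
          rule_format, THEN conjunct1, rule_format, OF _ lists.Nil] by simp
    with True show ?thesis by simp
  qed (use assms True in simp)
next
  case False
  then have "\<alpha> \<noteq> 0"
    using assms(2) zero_le_cord[of \<beta>] by (metis order_antisym)
  with assms False show ?thesis
    by (auto simp: simAK_nonzero)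
qed

lemma simAK_imp_sim: "simAK L A \<alpha> as bs \<Longrightarrow> sim L A \<alpha> as bs"
proof (induction \<alpha> arbitrary: as bs rule: less_induct)
  case (less \<alpha>)
  show ?case
  proof (cases \<alpha> rule: cord_cases)
    case 1
    with less.prems show ?thesis by (simp add: sim_0 simAK_0)
  next
    case (2 \<beta>)
    have AK: "(\<forall>cs\<in>lists (univ A). \<exists>ds\<in>lists (univ A).
          length cs = length ds \<and> simAK L A \<beta> (as @ cs) (bs @ ds)) \<and>
       (\<forall>ds\<in>lists (univ A). \<exists>cs\<in>lists (univ A).
          length cs = length ds \<and> simAK L A \<beta> (as @ cs) (bs @ ds))"
      using less.prems less_osuc[of \<beta>] unfolding 2 simAK_nonzero[OF osuc_neq_zero] by blast
    have "\<exists>d\<in>univ A. simAK L A \<beta> (as @ [c]) (bs @ [d])" if "c \<in> univ A" for c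
    proof -
      obtain ds where "ds \<in> lists (univ A)" "length ds = Suc 0" "simAK L A \<beta> (as @ [c]) (bs @ ds)"
        using AK[THEN conjunct1, rule_format, of "[c]"] \<open>c \<in> univ A\<close> by (auto simp: eq_commute[of "Suc 0"])
      then show ?thesis by (cases ds) auto
    qed
    moreover have "\<exists>c\<in>univ A. simAK L A \<beta> (as @ [c]) (bs @ [d])" if "d \<in> univ A" for d
    proof -
      obtain cs where "cs \<in> lists (univ A)" "length cs = Suc 0" "simAK L A \<beta> (as @ cs) (bs @ [d])"
        using AK[THEN conjunct2, rule_format, of "[d]"] \<open>d \<in> univ A\<close> by auto
      then show ?thesis by (cases cs) auto
    qed
    ultimately show ?thesis
      using less.IH[of \<beta>] less_osuc[of \<beta>] simAK_in_lists[OF less.prems]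
      unfolding 2 sim_osuc by meson
  next
    case 3
    with less simAK_mono[OF less.prems] show ?thesis
      by (simp add: sim_limit)
  qed
qed

text \<open>As \<open>osuc (f n) \<le> f (Suc n)\<close>, each single move lowers the level by one
  step of the sequence, and a tuple of length n uses n steps.\<close>

lemma sim_extend:
  assumes ne: "univ A \<noteq> {}" and incr: "\<And>n. f n < f (Suc n)"
  shows "sim L A (f (length cs)) as bs \<Longrightarrow> cs \<in> lists (univ A) \<Longrightarrow>
      \<exists>ds\<in>lists (univ A). length cs = length ds \<and> sim L A (f 0) (as @ cs) (bs @ ds)"
    and "sim L A (f (length ds)) as bs \<Longrightarrow> ds \<in> lists (univ A) \<Longrightarrow>
      \<exists>cs\<in>lists (univ A). length cs = length ds \<and> sim L A (f 0) (as @ cs) (bs @ ds)"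
proof -
  have osuc: "sim L A (osuc (f n)) xs ys" if "sim L A (f (Suc n)) xs ys" for n xs ys
    using sim_mono[OF ne that] incr by (simp add: osuc_le_iff)
  show "sim L A (f (length cs)) as bs \<Longrightarrow> cs \<in> lists (univ A) \<Longrightarrow>
      \<exists>ds\<in>lists (univ A). length cs = length ds \<and> sim L A (f 0) (as @ cs) (bs @ ds)"
  proof (induction cs arbitrary: as bs)
    case (Cons c cs)
    then obtain d where d: "d \<in> univ A" "sim L A (f (length cs)) (as @ [c]) (bs @ [d])"
      using osuc[of "length cs" as bs] unfolding sim_osuc by auto
    obtain ds where "ds \<in> lists (univ A)" "length cs = length ds"
      "sim L A (f 0) ((as @ [c]) @ cs) ((bs @ [d]) @ ds)"
      using Cons.IH[OF d(2)] Cons.prems(2) by auto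
    with d(1) show ?case
      by (intro bexI[of _ "d # ds"]) auto
  qed simp
  show "sim L A (f (length ds)) as bs \<Longrightarrow> ds \<in> lists (univ A) \<Longrightarrow>
      \<exists>cs\<in>lists (univ A). length cs = length ds \<and> sim L A (f 0) (as @ cs) (bs @ ds)"
  proof (induction ds arbitrary: as bs)
    case (Cons d ds)
    then obtain c where c: "c \<in> univ A" "sim L A (f (length ds)) (as @ [c]) (bs @ [d])"
      using osuc[of "length ds" as bs] unfolding sim_osuc by auto
    obtain cs where "cs \<in> lists (univ A)" "length cs = length ds"
      "sim L A (f 0) ((as @ [c]) @ cs) ((bs @ [d]) @ ds)"
      using Cons.IH[OF c(2)] Cons.prems(2) by auto
    with c(1) show ?case
      by (intro bexI[of _ "c # cs"]) auto
  qed simp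
qed

text \<open>The length of the tuple is chosen only after \<beta>. As \<open>f \<gamma> 0\<close>
  lies above every \<open>f \<beta> n\<close>, any length can be afforded, and level
  \<open>f \<beta> 0\<close> remains for the induction.\<close>

lemma sim_lex_imp_simAK:
  assumes ne: "univ A \<noteq> {}"
    and incr: "\<And>\<gamma> n. \<gamma> < \<alpha> \<Longrightarrow> f \<gamma> n < f \<gamma> (Suc n)"
    and lex: "\<And>\<beta> \<gamma> n. \<beta> < \<gamma> \<Longrightarrow> \<gamma> < \<alpha> \<Longrightarrow> f \<beta> n < f \<gamma> (0::nat)"
  shows "\<gamma> < \<alpha> \<Longrightarrow> sim L A (f \<gamma> 0) as bs \<Longrightarrow> simAK L A \<gamma> as bs"
proof (induction \<gamma> arbitrary: as bs rule: less_induct)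
  case (less \<gamma>)
  note sim = less.prems(2)
  show ?case
  proof (cases "\<gamma> = 0")
    case True
    with sim_mono[OF ne sim, of 0] show ?thesis
      by (simp add: sim_0 simAK_0)
  next
    case False
    have "(\<forall>cs\<in>lists (univ A). \<exists>ds\<in>lists (univ A).
          length cs = length ds \<and> simAK L A \<beta> (as @ cs) (bs @ ds)) \<and>
       (\<forall>ds\<in>lists (univ A). \<exists>cs\<in>lists (univ A).
          length cs = length ds \<and> simAK L A \<beta> (as @ cs) (bs @ ds))" if "\<beta> < \<gamma>" for \<beta>
    proof -
      have \<beta>: "\<beta> < \<alpha>" using that less.prems(1) by simp
      have "sim L A (f \<beta> n) as bs" for n
        using sim_mono[OF ne sim] lex[OF that less.prems(1)] by (simp add: less_imp_le)
      then show ?thesis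
        using sim_extend[of A "f \<beta>", OF ne incr[OF \<beta>]] less.IH[OF that \<beta>] by meson
    qed
    with sim_in_lists[OF sim] show ?thesis
      by (simp add: simAK_nonzero[OF False])
  qed
qed

text \<open>Of the countably many pairs, each that ever fails does so at a level below a common
  \<beta>. From \<beta> on \<open>sim\<close> no longer shrinks, so at \<beta> it has the extension
  property.\<close>

lemma ex_sim_imp_automorphic:
  assumes str: "is_structure L A" and ctbl: "countable (univ A)"
  shows "\<exists>\<alpha>. \<forall>as bs. sim L A \<alpha> as bs \<longrightarrow> automorphic L A as bs"
proof -
  have ne: "univ A \<noteq> {}" using str by (simp add: is_structure_def)
  define D where "D = {(as, bs). as \<in> lists (univ A) \<and> bs \<in> lists (univ A) \<and> (\<exists>\<alpha>. \<not> sim L A \<alpha> as bs)}"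
  have "countable D"
    by (rule countable_subset[of _ "lists (univ A) \<times> lists (univ A)"])
      (use ctbl in \<open>auto simp: D_def intro!: countable_SIGMA countable_lists\<close>)
  have "\<exists>\<alpha>. \<not> sim L A \<alpha> (fst P) (snd P)" if "P \<in> D" for P
    using that by (auto simp: D_def)
  then obtain \<alpha> where \<alpha>: "\<And>P. P \<in> D \<Longrightarrow> \<not> sim L A (\<alpha> P) (fst P) (snd P)"
    by metis
  obtain \<beta> where \<beta>: "\<And>P. P \<in> D \<Longrightarrow> \<alpha> P < \<beta>"
    using countable_cord_bounded[of "\<alpha> ` D"] \<open>countable D\<close> by auto
  have stable: "sim L A \<gamma> as bs" if "sim L A \<beta> as bs" for \<gamma> as bs
  proof (rule ccontr)
    assume "\<not> sim L A \<gamma> as bs"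
    then have "(as, bs) \<in> D"
      using sim_in_lists[OF that] by (auto simp: D_def)
    then show False
      using \<alpha> \<beta> sim_mono[OF ne that] by (metis fst_conv snd_conv less_imp_le)
  qed
  have "automorphic L A as bs" if sim: "sim L A \<beta> as bs" for as bs
  proof (rule back_and_forth[where E = "sim L A \<beta>", OF str ctbl _ _ _ sim])
    show "same_atomic_type L A as bs" if "sim L A \<beta> as bs" for as bs
      using stable[OF that, of 0] by (simp add: sim_0)
    show "\<exists>d\<in>univ A. sim L A \<beta> (as @ [c]) (bs @ [d])" if "sim L A \<beta> as bs" "c \<in> univ A" for as bs c
      using stable[OF that(1), of "osuc \<beta>"] that(2) by (simp add: sim_osuc)
    show "\<exists>c\<in>univ A. sim L A \<beta> (as @ [c]) (bs @ [d])" if "sim L A \<beta> as bs" "d \<in> univ A" for as bs d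
      using stable[OF that(1), of "osuc \<beta>"] that(2) by (simp add: sim_osuc)
  qed (use sim_in_lists[OF sim] in auto)
  then show ?thesis by blast
qed

subsection \<open>Copies\<close>

lemma ex_copy:
  fixes A :: "'a struct"
  assumes str: "is_structure L A" and ctbl: "countable (univ A)"
  shows "\<exists>B :: nat struct. is_structure L B \<and> (\<exists>h. isomorphism L A B h)"
proof -
  define h where "h = to_nat_on (univ A)"
  define k where "k = inv_into (univ A) h"
  have inj: "inj_on h (univ A)"
    unfolding h_def by (rule inj_on_to_nat_on[OF ctbl])
  have k: "k (h x) = x" if "x \<in> univ A" for x
    unfolding k_def using inj that by (rule inv_into_f_f)
  have map_k: "map k (map h as) = as" if "as \<in> lists (univ A)" for as
    using that k by (auto simp: in_lists_conv_set intro!: map_idI)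
  define B where "B = \<lparr>univ = h ` univ A, rel = (\<lambda>R ns. rel A R (map k ns)),
    func = (\<lambda>f ns. h (func A f (map k ns)))\<rparr>"
  have "is_structure L B"
    unfolding is_structure_def
  proof (intro conjI ballI impI)
    show "univ B \<noteq> {}"
      using str by (simp add: B_def is_structure_def)
    fix f ns assume f: "f \<in> funs L" "ns \<in> lists (univ B)" "length ns = fun_arity L f"
    then have "map k ns \<in> lists (univ A)"
      using k by (auto simp: B_def in_lists_conv_set)
    with f str show "func B f ns \<in> univ B"
      by (simp add: B_def is_structure_def)
  qed
  moreover have "isomorphism L A B h"
    unfolding isomorphism_def
    using inj by (auto simp: B_def bij_betw_def map_k simp del: map_map)
  ultimately show ?thesis by blast
qed

text \<open>The minimum is attained as soon as some oracle computes a copy, and a copy on natural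
  numbers is computed by its own diagram.\<close>

lemma omega1_eq_omega1_CK:
  assumes "is_structure L A" "countable (univ A)"
  shows "\<exists>X. omega1 L A = omega1_CK X"
proof -
  obtain B :: "nat struct" where "is_structure L B \<and> (\<exists>h. isomorphism L A B h)"
    using ex_copy[OF assms] by blast
  moreover have "computes_set (diagram L B) (diagram L B)"
    unfolding computes_set_def by (rule rec_in.orac)
  ultimately have "\<exists>\<alpha> X. computes_copy L X A \<and> \<alpha> = omega1_CK X"
    unfolding computes_copy_def by blast
  from LeastI_ex[OF this] show ?thesis
    unfolding omega1_def by blast
qed

subsection \<open>Comparison of the ranks\<close>

lemma sim_rho_sim_imp_automorphic:
  assumes "is_structure L A" "countable (univ A)"
  shows "sim L A (rho_sim L A as) as bs \<Longrightarrow> automorphic L A as bs"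
proof -
  have "\<exists>\<alpha>. \<forall>bs\<in>lists (univ A). sim L A \<alpha> as bs \<longrightarrow> automorphic L A as bs"
    using ex_sim_imp_automorphic[OF assms] by blast
  from LeastI_ex[OF this] show "sim L A (rho_sim L A as) as bs \<Longrightarrow> automorphic L A as bs"
    unfolding rho_sim_def using sim_in_lists by blast
qed

lemma rho_sim_le:
  "(\<And>bs. sim L A \<alpha> as bs \<Longrightarrow> automorphic L A as bs) \<Longrightarrow> rho_sim L A as \<le> \<alpha>"
  unfolding rho_sim_def by (rule Least_le) blast

lemma rho_AK_eq:
  assumes "is_structure L A" "countable (univ A)" "as \<in> lists (univ A)"
  shows "rho_AK L A as =
    (LEAST \<alpha>. \<forall>bs\<in>lists (univ A). simAK L A \<alpha> as bs \<longrightarrow> automorphic L A as bs)"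
  unfolding rho_AK_def by (simp add: same_fms_iff_automorphic[OF assms] cong: ball_cong)

lemma rho_AK_le_rho_sim:
  assumes "is_structure L A" "countable (univ A)" "as \<in> lists (univ A)"
  shows "rho_AK L A as \<le> rho_sim L A as"
  unfolding rho_AK_eq[OF assms]
  by (rule Least_le) (use sim_rho_sim_imp_automorphic[OF assms(1,2)] simAK_imp_sim in blast)

lemma simAK_rho_AK_imp_automorphic:
  assumes "is_structure L A" "countable (univ A)" "as \<in> lists (univ A)"
  shows "simAK L A (rho_AK L A as) as bs \<Longrightarrow> automorphic L A as bs"
proof -
  have "\<exists>\<alpha>. \<forall>bs\<in>lists (univ A). simAK L A \<alpha> as bs \<longrightarrow> automorphic L A as bs"
    using ex_sim_imp_automorphic[OF assms(1,2)] simAK_imp_sim by blast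
  from LeastI_ex[OF this] show "simAK L A (rho_AK L A as) as bs \<Longrightarrow> automorphic L A as bs"
    unfolding rho_AK_eq[OF assms] using simAK_in_lists by blast
qed

lemma osup_osuc_le_iff:
  assumes "countable S"
  shows "osup {osuc (\<rho> x) | x. x \<in> S} \<le> \<alpha> \<longleftrightarrow> (\<forall>x\<in>S. \<rho> x < \<alpha>)"
proof -
  have "countable {osuc (\<rho> x) | x. x \<in> S}"
    using assms by (simp add: setcompr_eq_image)
  then show ?thesis
    by (auto simp: osup_le_iff osuc_le_iff)
qed

theorem mainTheorem14:
  fixes L :: vocabulary and A :: "'a struct"
  assumes "is_structure L A" and "countable (univ A)"
  shows "(\<forall>v \<in> {omega1 L A, osuc (omega1 L A)}. SR_AK L A = v \<longleftrightarrow> SR_sim L A = v) \<and>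
    (SR_AK L A \<ge> omega1 L A \<longleftrightarrow> SR_sim L A \<ge> omega1 L A)"
proof -
  define \<Omega> where "\<Omega> = omega1 L A"
  obtain X where X: "\<Omega> = omega1_CK X"
    using omega1_eq_omega1_CK[OF assms] by (auto simp: \<Omega>_def)
  note osuc_less = osuc_less_omega1_CK[of _ X, folded X]
  have ne: "univ A \<noteq> {}" using assms(1) by (simp add: is_structure_def)
  \<comment> \<open>\<open>g \<gamma>\<close> plays the role of \<omega> \<cdot> \<gamma>, with one
    \<delta> above all of them.\<close>
  have bound: "\<exists>\<delta><\<Omega>. \<exists>g. \<forall>\<gamma><\<alpha>. g \<gamma> < \<delta> \<and> (\<forall>as bs. sim L A (g \<gamma>) as bs \<longrightarrow> simAK L A \<gamma> as bs)"
    if \<alpha>: "\<alpha> < \<Omega>" for \<alpha>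
  proof -
    obtain \<delta> and f :: "cord \<Rightarrow> nat \<Rightarrow> cord" where "\<delta> < \<Omega>"
      and less: "\<And>\<gamma> n. \<gamma> < \<alpha> \<Longrightarrow> f \<gamma> n < \<delta>"
      and incr: "\<And>\<gamma> n. \<gamma> < \<alpha> \<Longrightarrow> f \<gamma> n < f \<gamma> (Suc n)"
      and lex: "\<And>\<beta> \<gamma> n. \<beta> < \<gamma> \<Longrightarrow> \<gamma> < \<alpha> \<Longrightarrow> f \<beta> n < f \<gamma> 0"
      by (rule ex_lex_embedding[OF \<alpha>[unfolded X], folded X]) blast
    with sim_lex_imp_simAK[where A = A and \<alpha> = \<alpha> and f = f and L = L, OF ne incr lex] show ?thesis
      by (intro exI[of _ \<delta>] conjI exI[of _ "\<lambda>\<gamma>. f \<gamma> 0"]) auto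
  qed
  have rho_sim_le_bound: "rho_sim L A as \<le> \<beta>"
    if "as \<in> lists (univ A)" "\<And>bs. sim L A \<beta> as bs \<Longrightarrow> simAK L A (rho_AK L A as) as bs" for as \<beta>
    using that simAK_rho_AK_imp_automorphic[OF assms] by (intro rho_sim_le) blast
  have bounded: "\<exists>\<delta><\<Omega>. \<forall>as\<in>lists (univ A). rho_AK L A as < \<alpha> \<longrightarrow> rho_sim L A as < \<delta>"
    if \<alpha>: "\<alpha> < \<Omega>" for \<alpha>
  proof -
    obtain \<delta> g where "\<delta> < \<Omega>" and g: "\<forall>\<gamma><\<alpha>. g \<gamma> < \<delta> \<and>
        (\<forall>as bs. sim L A (g \<gamma>) as bs \<longrightarrow> simAK L A \<gamma> as bs)"
      using bound[OF \<alpha>] by blast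
    have "rho_sim L A as < \<delta>" if "as \<in> lists (univ A)" "rho_AK L A as < \<alpha>" for as
    proof -
      have "rho_sim L A as \<le> g (rho_AK L A as)"
        using g that by (intro rho_sim_le_bound) auto
      also have "\<dots> < \<delta>" using g that(2) by blast
      finally show ?thesis .
    qed
    with \<open>\<delta> < \<Omega>\<close> show ?thesis by blast
  qed
  have less: "rho_AK L A as < \<Omega> \<longleftrightarrow> rho_sim L A as < \<Omega>" if "as \<in> lists (univ A)" for as
  proof
    assume "rho_AK L A as < \<Omega>"
    then obtain \<delta> where "\<delta> < \<Omega>" "rho_sim L A as < \<delta>"
      using bounded[OF osuc_less] less_osuc \<open>as \<in> _\<close> by blast
    then show "rho_sim L A as < \<Omega>" by simp
  qed (use rho_AK_le_rho_sim[OF assms that] in simp)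
  have \<Omega>: "simAK L A \<Omega> as bs" if sim: "sim L A \<Omega> as bs" for as bs
  proof (cases "\<Omega> = 0")
    case True
    with sim show ?thesis by (simp add: sim_0 simAK_0)
  next
    case False
    \<comment> \<open>Level \<open>osuc \<gamma>\<close> supplies the extension property at
      \<gamma>, and \<open>simAK\<close> at a nonzero \<Omega> asks for exactly this at every
      \<gamma> < \<Omega>.\<close>
    have "simAK L A (osuc \<gamma>) as bs" if \<gamma>: "\<gamma> < \<Omega>" for \<gamma>
    proof -
      \<comment> \<open>\<open>bound\<close> covers indices strictly below its argument; to reach
        \<open>osuc \<gamma>\<close> it is applied one successor higher.\<close>
      obtain \<delta> g where "\<delta> < \<Omega>" and g: "\<forall>\<beta><osuc (osuc \<gamma>). g \<beta> < \<delta> \<and>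
          (\<forall>as bs. sim L A (g \<beta>) as bs \<longrightarrow> simAK L A \<beta> as bs)"
        using bound[OF osuc_less[OF osuc_less[OF \<gamma>]]] by blast
      note g = g[rule_format, OF less_osuc]
      then show ?thesis
        using sim_mono[OF ne sim, of "g (osuc \<gamma>)"] \<open>\<delta> < \<Omega>\<close>
        by (meson less_imp_le order.strict_trans)
    qed
    then show ?thesis
      using sim_in_lists[OF sim] less_osuc unfolding simAK_nonzero[OF False] simAK_nonzero[OF osuc_neq_zero]
      by blast
  qed
  have le: "rho_AK L A as \<le> \<Omega> \<longleftrightarrow> rho_sim L A as \<le> \<Omega>" if as: "as \<in> lists (univ A)" for as
    using rho_AK_le_rho_sim[OF assms as] rho_sim_le_bound[OF as, of \<Omega>] simAK_mono[OF \<Omega>] by auto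
  have "countable (lists (univ A))"
    using assms(2) by (rule countable_lists)
  then have SR_AK: "SR_AK L A \<le> \<alpha> \<longleftrightarrow> (\<forall>as\<in>lists (univ A). rho_AK L A as < \<alpha>)"
    and SR_sim: "SR_sim L A \<le> \<alpha> \<longleftrightarrow> (\<forall>as\<in>lists (univ A). rho_sim L A as < \<alpha>)" for \<alpha>
    unfolding SR_AK_def SR_sim_def by (intro osup_osuc_le_iff; assumption)+
  have "SR_AK L A \<le> SR_sim L A"
    using SR_sim[of "SR_sim L A"] rho_AK_le_rho_sim[OF assms]
    unfolding SR_AK by (auto intro: order.strict_trans1)
  \<comment> \<open>The rank \<open>SR_AK L A\<close> itself serves as the \<alpha> in
    \<open>bounded\<close>, since it strictly exceeds every \<open>rho_AK\<close>.\<close>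
  moreover have "SR_sim L A < \<Omega>" if AK: "SR_AK L A < \<Omega>"
  proof -
    obtain \<delta> where "\<delta> < \<Omega>" and "\<forall>as\<in>lists (univ A). rho_AK L A as < SR_AK L A \<longrightarrow> rho_sim L A as < \<delta>"
      using bounded[OF AK] by blast
    moreover have "\<forall>as\<in>lists (univ A). rho_AK L A as < SR_AK L A"
      using SR_AK[of "SR_AK L A"] by simp
    ultimately have "SR_sim L A \<le> \<delta>"
      using SR_sim by simp
    with \<open>\<delta> < \<Omega>\<close> show ?thesis by simp
  qed
  ultimately have ge: "\<Omega> \<le> SR_AK L A \<longleftrightarrow> \<Omega> \<le> SR_sim L A"
    by (metis not_le order.trans)
  have le_\<Omega>: "SR_AK L A \<le> \<Omega> \<longleftrightarrow> SR_sim L A \<le> \<Omega>"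
    using less by (simp add: SR_AK SR_sim)
  have le_osuc: "SR_AK L A \<le> osuc \<Omega> \<longleftrightarrow> SR_sim L A \<le> osuc \<Omega>"
    using le by (simp add: SR_AK SR_sim less_osuc_iff)
  have eq_osuc: "x = osuc \<Omega> \<longleftrightarrow> x \<le> osuc \<Omega> \<and> \<not> x \<le> \<Omega>" for x
    by (simp add: order.eq_iff osuc_le_iff not_le)
  have "SR_AK L A = \<Omega> \<longleftrightarrow> SR_sim L A = \<Omega>"
    unfolding order.eq_iff[of _ \<Omega>] le_\<Omega> ge ..
  moreover have "SR_AK L A = osuc \<Omega> \<longleftrightarrow> SR_sim L A = osuc \<Omega>"
    unfolding eq_osuc le_\<Omega> le_osuc ..
  ultimately show ?thesis
    using ge unfolding \<Omega>_def by simp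
qed

end
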